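(* Let $W\subset V\otimes\mathbb{R}^\ell$ be a geometric non-local space, let $\alpha=-\kappa'(1)/\log m$, where $\alpha\in(0,1)$, and let $\varphi\colon W\to V$ be a canceling linear operator. Then there is a constant $C$ (independent of $F$ and $\nu$) such that $$\int_{\mathbb{T}}\big|\mathbb{I}_\alpha[F]\big|\,d\nu\;\leq\; C\,\Big(\sup_{n\geq 0,\ \omega\in \mathcal{AF}_n} m^{(1-\alpha)n}\nu(\omega)\Big)\,\|F\|_{L_1}$$ for every simple martingale $F\in\mathbb{W}$ and every finite non-negative Borel measure $\nu$ on $\mathbb{T}$ for which the supremum is finite.
   Context: Fix integers $m\geq 2$, $\ell\geq 1$. $\mathbb{T}$ is the space of sequences $\gamma=(\gamma(0),\gamma(1),\dots)$ with digits in $\{1,\dots,m\}$ (product topology). $\mathcal{AF}_n$ is the set of atoms of level $n$: the $m^n$ cylinder sets obtained by prescribing the first $n$ digits ($\mathcal{AF}_0=\{\mathbb{T}\}$). The $j$-th kid $\omega_j\in\mathcal{AF}_{n+1}$ of $\omega\in\mathcal{AF}_n$ is obtained by prescribing the next digit to be $j$. $\mathcal{F}_n$ is the finite algebra generated by $\mathcal{AF}_n$; $\mathbb{T}$ carries the probability measure giving mass $m^{-n}$ to each atom of level $n$, and $\mathbb{E}$ is the expectation. Martingales $F=\{F_n\}_{n\ge0}$ are adapted to $\{\mathcal F_n\}$; $dF_{n+1}=F_{n+1}-F_n$; $\|F\|_{L_1}=\sup_n\mathbb{E}|F_n|$; $F$ is simple if $F_n=F_N$ for all $n\ge N$, for some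 $N$. The paper works with simple martingales. $V=\{v\in\mathbb{R}^m:\sum_j v_j=0\}$; $V\otimes\mathbb{R}^\ell$ is identified with $\{(w_1,\dots,w_m)\in(\mathbb{R}^\ell)^m:\sum_j w_j=0\}$, and $v\otimes a=(v_1a,\dots,v_ma)$. For $\omega\in\mathcal{AF}_n$ let $dF_{n+1}[\omega]\in V\otimes\mathbb{R}^\ell$ be the string of values of $dF_{n+1}$ on the kids $\omega_1,\dots,\omega_m$. For a linear subspace $W\subset V\otimes\mathbb{R}^\ell$, $\mathbb{W}$ is the set of $\mathbb{R}^\ell$-valued martingales $F$ with $\|F\|_{L_1}<\infty$ and $dF_{n+1}[\omega]\in W$ for all $n\geq0$, $\omega\in\mathcal{AF}_n$. For a linear $\varphi\colon W\to V$, $$\mathbb{I}_\alpha[F]=\sum_{n\ge0}m^{-\alpha n}\sum_{\omega\in\mathcal{AF}_n}\sum_{j=1}^m\big(\varphi(dF_{n+1}[\omega])\big)_j\,\chi_{\omega_j}.$$ Let $\mathbb{M}^W=\{v\in V: v_j\ge-1\ \forall j,\ \exists a\in\mathbb{R}^\ell\setminus\{0\}\text{ with }v\otimes a\in W\}$. For $v\in V$ put $\kappa_v(\theta)=\theta\log\big(\frac1m\sum_{j=1}^m|1+v_j|^{1/\theta}\big)$ for $\theta\in(0,1]$ and $\kappa_v(0)=\log\max_j|1+v_j|$; put $\kappa(\theta)=\sup_{v\in\mathbb{M}^W}\kappa_v(\theta)$, $\theta\in[0,1]$; $\kappa'(1)$ is the left derivative. $W$ is geometric if $\kappa$ is affine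 on $[0,1]$. For a geometric $W$ with $\alpha=-\kappa'(1)/\log m$, a vector $v\otimes a\in W$ with $v\in\mathbb{M}^W$, $a\neq0$ is extremal if $\frac1m\sum_j(1+v_j)\log(1+v_j)=\alpha\log m$ (with $0\log0=0$); its support is $H=\{j:1+v_j\ne0\}$. (Then $1+v_j=m^\alpha$ for $j\in H$.) $\varphi$ is canceling if $(\varphi[v\otimes a])_j=0$ for every $j\in H$, for every extremal $v\otimes a$ with support $H$. $W$ is non-local (of order $\alpha$) if for every extremal vector $v\otimes a$ with support $H$, every $w\in W$ and every $b\in\mathbb{R}^\ell$, the condition $b+w_j=0$ for all $j\notin H$ implies that $w$ is proportional to $v\otimes a$. *)

theory Defs
  imports "HOL-Probability.Probability"
begin

(* The digit alphabet is a finite type 'm (with CARD('m) = m) and R^l is real^'l (with l = CARD('l)).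
   A point of T is a function nat => 'm. *)

section \<open>The space T, atoms and measures\<close>

definition tree_top :: "(nat \<Rightarrow> 'm::finite) topology" where
  "tree_top = product_topology (\<lambda>_. discrete_topology UNIV) UNIV"

definition tree_borel :: "(nat \<Rightarrow> 'm::finite) measure" where
  "tree_borel = sigma UNIV {U. openin tree_top U}"

definition tree_prob :: "(nat \<Rightarrow> 'm::finite) measure" where
  "tree_prob = (\<Pi>\<^sub>M i\<in>UNIV. uniform_count_measure UNIV)"

definition cylinder :: "nat \<Rightarrow> (nat \<Rightarrow> 'm::finite) \<Rightarrow> (nat \<Rightarrow> 'm) set" where
  "cylinder n p = {\<gamma>. \<forall>i<n. \<gamma> i = p i}"

definition atoms :: "nat \<Rightarrow> (nat \<Rightarrow> 'm::finite) set set" where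
  "atoms n = range (cylinder n)"

(* \<omega> is meant to be an atom of level n; the level is an explicit argument. *)
definition kid :: "nat \<Rightarrow> (nat \<Rightarrow> 'm::finite) set \<Rightarrow> 'm \<Rightarrow> (nat \<Rightarrow> 'm) set" where
  "kid n \<omega> j = {\<gamma> \<in> \<omega>. \<gamma> n = j}"

(* The algebra generated by the atoms of level n; it is finite, hence equal to the
   sigma-algebra they generate. *)
definition level_algebra :: "nat \<Rightarrow> (nat \<Rightarrow> 'm::finite) measure" where
  "level_algebra n = sigma UNIV (atoms n)"

lemma finite_atoms: "finite (atoms n :: (nat \<Rightarrow> 'm::finite) set set)"
proof -
  have "atoms n \<subseteq> (cylinder n :: (nat \<Rightarrow> 'm) \<Rightarrow> _) ` (PiE {..<n} (\<lambda>_. UNIV))"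
  proof
    fix \<omega> :: "(nat \<Rightarrow> 'm) set" assume "\<omega> \<in> atoms n"
    then obtain p where p: "\<omega> = cylinder n p" by (auto simp: atoms_def)
    have "\<omega> = cylinder n (restrict p {..<n})" unfolding p cylinder_def by auto
    then show "\<omega> \<in> cylinder n ` (PiE {..<n} (\<lambda>_. UNIV))" by auto
  qed
  then show ?thesis by (rule finite_subset) (auto intro!: finite_PiE)
qed

lemma openin_cylinder: "openin tree_top (cylinder n p)"
proof -
  have "cylinder n p = (\<Pi>\<^sub>E i\<in>UNIV. if i < n then {p i} else UNIV)"
    by (auto simp: cylinder_def PiE_def Pi_def split: if_splits)
  moreover have "finite {i. (if i < n then {p i} else UNIV) \<noteq> topspace (discrete_topology UNIV)}"
    by (rule finite_subset[of _ "{..<n}"]) auto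
  ultimately show ?thesis
    unfolding tree_top_def by (simp add: product_topology_basis)
qed

lemma sets_tree_borel: "sets tree_borel = sets (tree_prob :: (nat \<Rightarrow> 'm::finite) measure)"
proof -
  have sp: "space (tree_prob :: (nat \<Rightarrow> 'm) measure) = UNIV"
    by (simp add: tree_prob_def space_PiM space_uniform_count_measure)
  have cylM: "cylinder n p \<in> sets tree_prob" for n and p :: "nat \<Rightarrow> 'm"
  proof -
    have "Measurable.pred tree_prob (\<lambda>\<gamma>::nat \<Rightarrow> 'm. \<forall>i\<in>{..<n}. \<gamma> i \<in> {p i})"
      unfolding tree_prob_def by measurable
    then have "{\<gamma>\<in>space tree_prob. \<forall>i\<in>{..<n}. \<gamma> i \<in> {p i}} \<in> sets tree_prob" by measurable
    then show ?thesis by (simp add: sp cylinder_def Ball_def)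
  qed
  have op: "U \<in> sets tree_prob" if "openin tree_top U" for U :: "(nat \<Rightarrow> 'm) set"
  proof -
    have "\<exists>n. cylinder n \<gamma> \<subseteq> U" if g: "\<gamma> \<in> U" for \<gamma>
    proof -
      obtain X where X: "\<gamma> \<in> (\<Pi>\<^sub>E i\<in>UNIV. X i)" "finite {i. X i \<noteq> topspace (discrete_topology UNIV)}"
        "(\<Pi>\<^sub>E i\<in>UNIV. X i) \<subseteq> U"
        using product_topology_open_contains_basis[OF \<open>openin tree_top U\<close>[unfolded tree_top_def] g]
        by metis
      obtain n where n: "{i. X i \<noteq> UNIV} \<subseteq> {..<n}" using X(2) finite_nat_iff_bounded by auto
      have "cylinder n \<gamma> \<subseteq> (\<Pi>\<^sub>E i\<in>UNIV. X i)"
      proof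
        fix d assume d: "d \<in> cylinder n \<gamma>"
        have "d i \<in> X i" for i
          using d n X(1) by (cases "X i = UNIV") (auto simp: cylinder_def PiE_def Pi_def)
        then show "d \<in> (\<Pi>\<^sub>E i\<in>UNIV. X i)" by auto
      qed
      then show ?thesis using X(3) by blast
    qed
    then have cov: "\<exists>\<omega>\<in>(\<Union>n. atoms n). \<gamma> \<in> \<omega> \<and> \<omega> \<subseteq> U" if g: "\<gamma> \<in> U" for \<gamma>
    proof -
      obtain n where "cylinder n \<gamma> \<subseteq> U"
        using \<open>\<And>\<gamma>. \<gamma> \<in> U \<Longrightarrow> \<exists>n. cylinder n \<gamma> \<subseteq> U\<close>[OF g] ..
      moreover have "cylinder n \<gamma> \<in> (\<Union>n. atoms n)" "\<gamma> \<in> cylinder n \<gamma>"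
        by (auto simp: atoms_def cylinder_def)
      ultimately show ?thesis by blast
    qed
    define B where "B = {\<omega> \<in> (\<Union>n. atoms n). \<omega> \<subseteq> U}"
    have "U = \<Union>B"
    proof (rule antisym)
      show "U \<subseteq> \<Union>B"
      proof
        fix \<gamma> assume "\<gamma> \<in> U"
        from cov[OF this] show "\<gamma> \<in> \<Union>B" unfolding B_def by blast
      qed
      show "\<Union>B \<subseteq> U" unfolding B_def by blast
    qed
    moreover have "countable B"
      unfolding B_def
      by (rule countable_subset[of _ "\<Union>n. atoms n"]) (auto intro: countable_finite finite_atoms)
    moreover have "B \<subseteq> sets tree_prob"
      using cylM by (auto simp: B_def atoms_def)
    ultimately show ?thesis
      using sets.countable_Union[of B tree_prob] by simp
  qed
  have "sets tree_prob \<subseteq> sigma_sets UNIV {U :: (nat \<Rightarrow> 'm) set. openin tree_top U}"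
    unfolding tree_prob_def sets_PiM_single
  proof (rule order_trans[OF eq_refl sigma_sets_subseteq])
    show "sigma_sets (\<Pi>\<^sub>E i\<in>UNIV. space (uniform_count_measure (UNIV :: 'm set)))
        {{f \<in> \<Pi>\<^sub>E i\<in>UNIV. space (uniform_count_measure UNIV). f i \<in> A} |i A.
          i \<in> UNIV \<and> A \<in> sets (uniform_count_measure UNIV)}
      = sigma_sets UNIV {{f :: nat \<Rightarrow> 'm. f i \<in> A} |i A. True}"
      by (simp add: space_uniform_count_measure sets_uniform_count_measure)
    show "{{f :: nat \<Rightarrow> 'm. f i \<in> A} |i A. True} \<subseteq> {U. openin tree_top U}"
    proof clarify
      fix i :: nat and A :: "'m set"
      have "{f. f i \<in> A} = {f \<in> topspace tree_top. f i \<in> A}" by (simp add: tree_top_def)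
      moreover have "openin tree_top {f \<in> topspace tree_top. f i \<in> A}"
        unfolding tree_top_def
        by (rule openin_continuous_map_preimage[OF continuous_map_product_projection]) auto
      ultimately show "openin tree_top {f. f i \<in> A}" by simp
    qed
  qed
  moreover have "sigma_sets UNIV {U :: (nat \<Rightarrow> 'm) set. openin tree_top U} \<subseteq> sets tree_prob"
    using sets.sigma_sets_subset[of "{U. openin tree_top U}" "tree_prob :: (nat \<Rightarrow> 'm) measure"] op
    unfolding sp by blast
  ultimately show ?thesis by (auto simp: tree_borel_def)
qed

lemma prob_space_tree_prob: "prob_space (tree_prob :: (nat \<Rightarrow> 'm::finite) measure)"
  unfolding tree_prob_def
  by (intro prob_space_PiM prob_space_uniform_count_measure) auto

lemma emeasure_tree_prob_atom:
  assumes "\<omega> \<in> atoms n"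
  shows "emeasure (tree_prob :: (nat \<Rightarrow> 'm::finite) measure) \<omega> = ennreal ((1 / real CARD('m)) ^ n)"
proof -
  obtain p where p: "\<omega> = cylinder n p" using assms by (auto simp: atoms_def)
  interpret P: product_prob_space "\<lambda>_::nat. uniform_count_measure (UNIV :: 'm set)" UNIV
    by (intro product_prob_spaceI prob_space_uniform_count_measure) auto
  have "emeasure tree_prob {\<gamma> \<in> space tree_prob. \<forall>i\<in>{..<n}. \<gamma> i \<in> {p i}}
      = (\<Prod>i<n. emeasure (uniform_count_measure UNIV) {p i})"
    unfolding tree_prob_def
    by (rule P.emeasure_PiM_Collect) (auto simp: sets_uniform_count_measure)
  moreover have "emeasure (uniform_count_measure UNIV) {p i} = ennreal (1 / real CARD('m))" for i
    by (subst emeasure_uniform_count_measure) auto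
  ultimately show ?thesis
    by (simp add: p cylinder_def tree_prob_def space_PiM space_uniform_count_measure Ball_def
        ennreal_power)
qed

section \<open>Martingales\<close>

definition tree_martingale :: "(nat \<Rightarrow> (nat \<Rightarrow> 'm::finite) \<Rightarrow> real ^ 'l::finite) \<Rightarrow> bool" where
  "tree_martingale F \<longleftrightarrow>
     (\<forall>n. F n \<in> borel_measurable (level_algebra n)) \<and>
     (\<forall>n. integrable tree_prob (F n)) \<and>
     (\<forall>n. \<forall>A\<in>sets (level_algebra n).
        (LINT \<gamma>:A|tree_prob. F (Suc n) \<gamma>) = (LINT \<gamma>:A|tree_prob. F n \<gamma>))"

definition simple_martingale :: "(nat \<Rightarrow> (nat \<Rightarrow> 'm::finite) \<Rightarrow> real ^ 'l::finite) \<Rightarrow> bool" where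
  "simple_martingale F \<longleftrightarrow> tree_martingale F \<and> (\<exists>N. \<forall>n\<ge>N. F n = F N)"

definition L1_norm :: "(nat \<Rightarrow> (nat \<Rightarrow> 'm::finite) \<Rightarrow> real ^ 'l::finite) \<Rightarrow> ennreal" where
  "L1_norm F = (SUP n. \<integral>\<^sup>+ \<gamma>. ennreal (norm (F n \<gamma>)) \<partial>tree_prob)"

(* The string of the (constant) values of dF_{n+1} on the kids of the level-n atom \<omega>. *)
definition diff_string ::
  "(nat \<Rightarrow> (nat \<Rightarrow> 'm::finite) \<Rightarrow> real ^ 'l::finite) \<Rightarrow> nat \<Rightarrow> (nat \<Rightarrow> 'm) set \<Rightarrow> real ^ 'l ^ 'm"
  where "diff_string F n \<omega> = (\<chi> j. the_elem ((\<lambda>\<gamma>. F (Suc n) \<gamma> - F n \<gamma>) ` kid n \<omega> j))"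

section \<open>The spaces V, V (x) R^l, and the martingale spaces\<close>

definition V_space :: "(real ^ 'm::finite) set" where
  "V_space = {v. (\<Sum>j\<in>UNIV. v $ j) = 0}"

definition VR_space :: "(real ^ 'l::finite ^ 'm::finite) set" where
  "VR_space = {w. (\<Sum>j\<in>UNIV. w $ j) = 0}"

definition tensor :: "real ^ 'm::finite \<Rightarrow> real ^ 'l::finite \<Rightarrow> real ^ 'l ^ 'm" where
  "tensor v a = (\<chi> j. v $ j *\<^sub>R a)"

definition martingale_space ::
  "(real ^ 'l::finite ^ 'm::finite) set \<Rightarrow> (nat \<Rightarrow> (nat \<Rightarrow> 'm) \<Rightarrow> real ^ 'l) set" where
  "martingale_space W = {F. tree_martingale F \<and> L1_norm F < \<infinity> \<and>
     (\<forall>n. \<forall>\<omega>\<in>atoms n. diff_string F n \<omega> \<in> W)}"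

definition linear_into_V ::
  "(real ^ 'l::finite ^ 'm::finite) set \<Rightarrow> (real ^ 'l ^ 'm \<Rightarrow> real ^ 'm) \<Rightarrow> bool" where
  "linear_into_V W \<phi> \<longleftrightarrow>
     (\<forall>x\<in>W. \<phi> x \<in> V_space) \<and>
     (\<forall>x\<in>W. \<forall>y\<in>W. \<phi> (x + y) = \<phi> x + \<phi> y) \<and>
     (\<forall>c. \<forall>x\<in>W. \<phi> (c *\<^sub>R x) = c *\<^sub>R \<phi> x)"

(* For a simple martingale all but finitely many summands vanish. *)
definition riesz_potential ::
  "real \<Rightarrow> (real ^ 'l::finite ^ 'm::finite \<Rightarrow> real ^ 'm) \<Rightarrow> (nat \<Rightarrow> (nat \<Rightarrow> 'm) \<Rightarrow> real ^ 'l) \<Rightarrow>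
   (nat \<Rightarrow> 'm) \<Rightarrow> real" where
  "riesz_potential \<alpha> \<phi> F \<gamma> =
     (\<Sum>n. real CARD('m) powr (- \<alpha> * real n) *
        (\<Sum>\<omega>\<in>atoms n. \<Sum>j\<in>UNIV. \<phi> (diff_string F n \<omega>) $ j * indicator (kid n \<omega> j) \<gamma>))"

section \<open>Geometric, canceling and non-local\<close>

definition M_set :: "(real ^ 'l::finite ^ 'm::finite) set \<Rightarrow> (real ^ 'm) set" where
  "M_set W = {v \<in> V_space. (\<forall>j. v $ j \<ge> -1) \<and> (\<exists>a. a \<noteq> 0 \<and> tensor v a \<in> W)}"

definition kappa_vec :: "real ^ 'm::finite \<Rightarrow> real \<Rightarrow> real" where
  "kappa_vec v \<theta> =
     (if \<theta> = 0 then ln (MAX j\<in>UNIV. \<bar>1 + v $ j\<bar>)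
      else \<theta> * ln (1 / real CARD('m) * (\<Sum>j\<in>UNIV. \<bar>1 + v $ j\<bar> powr (1 / \<theta>))))"

(* Only used for \<theta> in [0,1].  There kappa_vec v \<theta> \<le> ln CARD('m) on M_set W, and 0 lies in M_set W
   for a linear subspace W, so this is a supremum of a nonempty bounded set. *)
definition kappa :: "(real ^ 'l::finite ^ 'm::finite) set \<Rightarrow> real \<Rightarrow> real" where
  "kappa W \<theta> = (SUP v\<in>M_set W. kappa_vec v \<theta>)"

(* For a geometric W the function kappa W is affine on [0,1], so the left derivative at 1 exists. *)
definition left_deriv :: "(real \<Rightarrow> real) \<Rightarrow> real \<Rightarrow> real" where
  "left_deriv f x = (THE D. (f has_real_derivative D) (at_left x))"

definition geometric :: "(real ^ 'l::finite ^ 'm::finite) set \<Rightarrow> bool" where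
  "geometric W \<longleftrightarrow> (\<exists>c d. \<forall>\<theta>\<in>{0..1}. kappa W \<theta> = c + d * \<theta>)"

definition order_of_space :: "(real ^ 'l::finite ^ 'm::finite) set \<Rightarrow> real" where
  "order_of_space W = - left_deriv (kappa W) 1 / ln (real CARD('m))"

(* 0 * ln 0 = 0 holds in HOL, matching the convention 0 log 0 = 0. *)
definition extremal ::
  "real \<Rightarrow> (real ^ 'l::finite ^ 'm::finite) set \<Rightarrow> real ^ 'm \<Rightarrow> real ^ 'l \<Rightarrow> bool" where
  "extremal \<alpha> W v a \<longleftrightarrow> tensor v a \<in> W \<and> v \<in> M_set W \<and> a \<noteq> 0 \<and>
     1 / real CARD('m) * (\<Sum>j\<in>UNIV. (1 + v $ j) * ln (1 + v $ j)) = \<alpha> * ln (real CARD('m))"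

definition ext_support :: "real ^ 'm::finite \<Rightarrow> 'm set" where
  "ext_support v = {j. 1 + v $ j \<noteq> 0}"

definition canceling ::
  "real \<Rightarrow> (real ^ 'l::finite ^ 'm::finite) set \<Rightarrow> (real ^ 'l ^ 'm \<Rightarrow> real ^ 'm) \<Rightarrow> bool" where
  "canceling \<alpha> W \<phi> \<longleftrightarrow>
     (\<forall>v a. extremal \<alpha> W v a \<longrightarrow> (\<forall>j\<in>ext_support v. \<phi> (tensor v a) $ j = 0))"

definition nonlocal :: "real \<Rightarrow> (real ^ 'l::finite ^ 'm::finite) set \<Rightarrow> bool" where
  "nonlocal \<alpha> W \<longleftrightarrow>
     (\<forall>v a. extremal \<alpha> W v a \<longrightarrow>
        (\<forall>w\<in>W. \<forall>b. (\<forall>j. j \<notin> ext_support v \<longrightarrow> b + w $ j = 0) \<longrightarrow> (\<exists>c. w = c *\<^sub>R tensor v a)))"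

end

theory Submission
  imports Defs
begin

text \<open>
Write \<open>m\<close> for the number of digits and \<open>A = m\<^sup>\<alpha>\<close>.  The proof produces a Bellman function.  For an atom of level \<open>n\<close>
let \<open>x\<close> be the value of the martingale on it and \<open>t \<in> [0, 1]\<close> the measure of the atom in units of the largest value
\<open>A0 m\<^bsup>-(1 - \<alpha>) n\<^esup>\<close> that the Morrey condition admits.  If, for suitable constants, the contribution of an atom to the
integral is at most a fixed multiple of the expected increase of \<open>U(x, t) = C1 \<bar>x\<bar> - C2 \<bar>x\<bar> \<surd>t\<close> from the atom to its kids, then the
contributions telescope over the tree (\<open>telescoped_estimate\<close>) and the total is at most
a multiple of the supremum of the expectations of \<open>\<bar>F\<^sub>n\<bar>\<close>, because \<open>0 \<le> \<surd>t \<le> 1\<close>.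

So everything rests on an inequality for a single vector \<open>x\<close> and a single string \<open>w \<in> W\<close>, \<open>bellman_inequality\<close>.
The part \<open>C1 \<bar>x\<bar>\<close> pays for all steps in which the mean of the norm grows.  It pays nothing when all kids carry
nonnegative multiples of \<open>x\<close>, that is, \<open>w = v \<otimes> x\<close> with \<open>v \<in> M_set W\<close>.  For these, geometricity says
\<open>1 + v\<^sub>j \<le> A\<close> (\<open>geometric_imp_M_set_bounded\<close>), and concavity of the square root makes \<open>- \<bar>x\<bar> \<surd>t\<close> increase, strictly
for \<open>x \<noteq> 0\<close> and \<open>t > 0\<close> unless \<open>1 + v\<close> takes only the values \<open>0\<close> and \<open>A\<close>; these \<open>v\<close> are the extremal ones.  At an extremal vector the
canceling condition kills the contribution of the support, and outside the support \<open>- \<bar>x\<bar> \<surd>t\<close> gains from the measure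
that is wasted on kids where the martingale vanishes.

What remains is a quantitative version near extremal vectors.  Young's inequality, applied kid by kid, eliminates the
measure (\<open>young_kid\<close>) and leaves the following claim for \<open>\<bar>x\<bar> = 1\<close> and bounded \<open>w\<close>:
\<open>\<Sum>\<^sub>j \<bar>\<phi>(w)\<^sub>j\<bar> \<bar>x + w\<^sub>j\<bar>\<^sup>2\<close> is at most a combination, with nonnegative coefficients, of \<open>\<Sum>\<^sub>j \<bar>x + w\<^sub>j\<bar> - m\<close> and
\<open>m A - \<Sum>\<^sub>j \<bar>x + w\<^sub>j\<bar>\<^sup>2\<close> (\<open>local_estimate_sphere\<close>).  Both terms vanish at an extremal vector.  Near it, let
\<open>s\<close> be the sum of \<open>\<bar>x + w\<^sub>j\<bar>\<close> over the kids outside the support.  Non-locality, a statement about the kernel of a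
linear map, says that \<open>(x, w)\<close> is within \<open>O(s)\<close> of the line of pairs \<open>(c a, c v \<otimes> a)\<close>
(\<open>nonlocal_estimate\<close>).  Hence the left-hand side is \<open>O(s)\<close>, while a suitable combination of the two terms on the right
is at least \<open>2 A s - O(s\<^sup>2)\<close> (\<open>near_extremal_estimate\<close>).  Compactness does the rest.
\<close>

section \<open>Growth of nonnegative steps in a geometric space\<close>

lemma M_set_sum:
  fixes v :: "real ^ 'm::finite"
  assumes "v \<in> M_set W"
  shows "(\<Sum>j\<in>UNIV. 1 + v $ j) = real CARD('m)"
  using assms by (simp add: M_set_def V_space_def sum.distrib)

lemma M_set_nonneg: "v \<in> M_set W \<Longrightarrow> 0 \<le> 1 + v $ j"
  by (auto simp: M_set_def dest!: spec[of _ j])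

lemma M_set_zero:
  fixes W :: "(real ^ 'l::finite ^ 'm::finite) set"
  assumes "subspace W"
  shows "0 \<in> M_set W"
proof -
  have "tensor (0::real^'m) (1::real^'l) = 0"
    by (simp add: tensor_def vec_eq_iff)
  then show ?thesis
    using assms by (auto simp: M_set_def V_space_def subspace_0 intro!: exI[of _ "1::real^'l"])
qed

lemma kappa_at_1:
  fixes W :: "(real ^ 'l::finite ^ 'm::finite) set"
  assumes "subspace W"
  shows "kappa W 1 = 0"
proof -
  have "kappa_vec v 1 = 0" if "v \<in> M_set W" for v
  proof -
    have "(\<Sum>j\<in>UNIV. \<bar>1 + v $ j\<bar> powr (1 / 1)) = (\<Sum>j\<in>UNIV. 1 + v $ j)"
      using M_set_nonneg[OF that] by (intro sum.cong) (auto simp: abs_of_nonneg)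
    then show ?thesis
      using M_set_sum[OF that] by (simp add: kappa_vec_def)
  qed
  then have "(\<lambda>v. kappa_vec v 1) ` M_set W = {0}"
    using M_set_zero[OF assms] by force
  then show ?thesis by (simp add: kappa_def)
qed

text \<open>At \<open>\<theta> = 1\<close> every \<open>kappa_vec v\<close> vanishes on \<open>M_set W\<close>, because \<open>1 + v\<close> is nonnegative with mean one.
So an affine \<open>kappa\<close> has \<open>kappa 0 = - kappa' 1\<close>, and this number is \<open>\<alpha> ln m\<close>.  The value at
\<open>0\<close> is the supremum of \<open>ln (max\<^sub>j (1 + v\<^sub>j))\<close>: a nonnegative martingale step multiplies the value
by at most \<open>m\<^sup>\<alpha>\<close>.  This bound is the form in which geometricity enters the argument.\<close>

lemma geometric_imp_M_set_bounded:
  fixes W :: "(real ^ 'l::finite ^ 'm::finite) set"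
  assumes m2: "CARD('m) \<ge> 2" and sub: "subspace W" and geo: "geometric W"
    and v: "v \<in> M_set W"
  shows "1 + v $ j \<le> real CARD('m) powr order_of_space W"
proof -
  obtain c d where cd: "\<And>\<theta>. 0 \<le> \<theta> \<Longrightarrow> \<theta> \<le> 1 \<Longrightarrow> kappa W \<theta> = c + d * \<theta>"
    using geo by (auto simp: geometric_def)
  have der: "(kappa W has_real_derivative d) (at_left 1)"
  proof -
    have "((\<lambda>\<theta>. c + d * \<theta>) has_real_derivative d) (at_left 1)"
      by (auto intro!: derivative_eq_intros)
    then show ?thesis
      by (rule has_field_derivative_cong_eventually[THEN iffD1, rotated -1])
         (use cd eventually_at_left[of 0 "1::real"] in \<open>auto intro!: exI[of _ 0]\<close>)
  qed
  have "left_deriv (kappa W) 1 = d"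
    unfolding left_deriv_def
  proof (rule the_equality)
    show "(kappa W has_real_derivative d) (at_left 1)" by (fact der)
  next
    fix D assume "(kappa W has_real_derivative D) (at_left 1)"
    then show "D = d"
      using der unfolding has_field_derivative_iff by (rule tendsto_unique[OF trivial_limit_at_left_real])
  qed
  moreover have "c + d = 0" using cd[of 1] kappa_at_1[OF sub] by simp
  ultimately have k0: "kappa W 0 = order_of_space W * ln (real CARD('m))"
    using cd[of 0] m2 by (simp add: order_of_space_def)
  have pos: "0 < (MAX j\<in>UNIV. \<bar>1 + v $ j\<bar>)" if "v \<in> M_set W" for v
  proof (rule ccontr)
    assume "\<not> ?thesis"
    then have "\<bar>1 + v $ j\<bar> \<le> 0" for j
      by (meson Max_ge finite finite_imageI imageI UNIV_I order_trans not_less)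
    then have "(\<Sum>j\<in>UNIV. 1 + v $ j) = 0" by simp
    then show False using M_set_sum[OF that] m2 by simp
  qed
  have le: "kappa_vec v 0 \<le> ln (real CARD('m))" if "v \<in> M_set W" for v
  proof -
    note nn = M_set_nonneg[OF that]
    have "1 + v $ j \<le> real CARD('m)" for j
      using member_le_sum[of j UNIV "\<lambda>j. 1 + v $ j"] nn M_set_sum[OF that] by auto
    then have "(MAX j\<in>UNIV. \<bar>1 + v $ j\<bar>) \<le> real CARD('m)"
      using nn by (subst Max_le_iff) auto
    then show ?thesis
      using pos[OF that] m2 by (simp add: kappa_vec_def)
  qed
  have "kappa_vec v 0 \<le> kappa W 0"
    unfolding kappa_def
    by (rule cSUP_upper[OF v]) (auto intro!: bdd_aboveI[of _ "ln (real CARD('m))"] le)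
  moreover define M where "M = (MAX j\<in>UNIV. \<bar>1 + v $ j\<bar>)"
  ultimately have "ln M \<le> order_of_space W * ln (real CARD('m))"
    by (simp add: k0 kappa_vec_def)
  also have "\<dots> = ln (real CARD('m) powr order_of_space W)" using m2 by (simp add: ln_powr)
  finally have "M \<le> real CARD('m) powr order_of_space W"
    using pos[OF v] m2 by (subst (asm) ln_le_cancel_iff) (auto simp only: M_def, simp)
  moreover have "\<bar>1 + v $ j\<bar> \<le> M" unfolding M_def by (intro Max_ge) auto
  ultimately show ?thesis by linarith
qed

section \<open>Boundedness of the operator\<close>

lemma linear_into_V_zero:
  assumes "subspace W" "linear_into_V W \<phi>"
  shows "\<phi> 0 = 0"
  using assms(2) subspace_0[OF assms(1)] unfolding linear_into_V_def by (metis scaleR_zero_left)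

text \<open>Since \<open>\<phi>\<close> is constrained on \<open>W\<close> alone, it is first replaced by a linear map on the whole space that
agrees with it on \<open>W\<close>.\<close>

lemma linear_into_V_bounded:
  fixes W :: "(real ^ 'l::finite ^ 'm::finite) set"
  assumes sub: "subspace W" and phi: "linear_into_V W \<phi>"
  shows "\<exists>K>0. \<forall>w\<in>W. \<forall>j. \<bar>\<phi> w $ j\<bar> \<le> K * norm w"
proof -
  obtain B where B: "B \<subseteq> W" "independent B" "span B = W"
    by (metis orthonormal_basis_subspace[OF sub])
  obtain g where g: "linear g" "\<And>b. b \<in> B \<Longrightarrow> g b = \<phi> b"
    using linear_independent_extend[OF B(2), of \<phi>] by auto
  note phi0 = linear_into_V_zero[OF sub phi]
  have "subspace {w \<in> W. g w = \<phi> w}"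
    using sub phi phi0 g(1)
    by (auto simp: subspace_def linear_into_V_def linear_add linear_scale linear_0)
  then have "g w = \<phi> w" if "w \<in> W" for w
    using span_minimal[of B "{w \<in> W. g w = \<phi> w}"] B g(2) that by auto
  moreover obtain K where "K > 0" "\<And>w. norm (g w) \<le> K * norm w"
    using linear_bounded_pos[OF g(1)] by blast
  ultimately show ?thesis
    by (metis component_le_norm_cart order_trans)
qed

section \<open>Defects of a single step and extremal vectors\<close>

text \<open>For a parent value \<open>x\<close> and a string \<open>w\<close> of increments, this is \<open>m\<close> times the growth of the mean of the
norm in one step.  If \<open>w\<close> sums to zero, it vanishes exactly when all kids carry nonnegative multiples of \<open>x\<close>.\<close>

definition l1_defect :: "real ^ 'l::finite \<Rightarrow> real ^ 'l ^ 'm::finite \<Rightarrow> real" where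
  "l1_defect x w = (\<Sum>j\<in>UNIV. norm (x + w $ j)) - real CARD('m) * norm x"

text \<open>If \<open>w\<close> sums to zero, this equals \<open>m (A - 1) \<bar>x\<bar>\<^sup>2 - \<bar>w\<bar>\<^sup>2\<close>.  For \<open>x + w\<^sub>j = y\<^sub>j x\<close> with \<open>\<bar>x\<bar> = 1\<close>, \<open>0 \<le> y\<^sub>j \<le> A\<close>
and \<open>\<Sum> y\<^sub>j = m\<close> it is \<open>\<Sum> y\<^sub>j (A - y\<^sub>j)\<close>, which vanishes only when every \<open>y\<^sub>j\<close> is \<open>0\<close> or \<open>A\<close>.  It measures
how far a degenerate step is from an extremal one.\<close>

definition l2_defect :: "real \<Rightarrow> real ^ 'l::finite \<Rightarrow> real ^ 'l ^ 'm::finite \<Rightarrow> real" where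
  "l2_defect A x w = real CARD('m) * A * (norm x)\<^sup>2 - (\<Sum>j\<in>UNIV. (norm (x + w $ j))\<^sup>2)"

lemma l1_defect_nonneg:
  fixes w :: "real ^ 'l::finite ^ 'm::finite"
  assumes "w \<in> VR_space"
  shows "0 \<le> l1_defect x w"
proof -
  have "(\<Sum>j\<in>UNIV. x + w $ j) = real CARD('m) *\<^sub>R x"
    using assms by (simp add: VR_space_def sum.distrib scaleR_conv_of_real vec_eq_iff)
  then have "real CARD('m) * norm x \<le> (\<Sum>j\<in>UNIV. norm (x + w $ j))"
    using norm_sum[of "\<lambda>j. x + w $ j" UNIV] by simp
  then show ?thesis by (simp add: l1_defect_def)
qed

lemma norm_le_sum_norm_nth: "norm w \<le> (\<Sum>j\<in>UNIV. norm (w $ j))"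
  unfolding norm_vec_def by (rule L2_set_le_sum) simp

lemma norm_power2_vec: "(norm w)\<^sup>2 = (\<Sum>j\<in>UNIV. (norm (w $ j))\<^sup>2)"
  by (simp add: norm_vec_def L2_set_def sum_nonneg)

text \<open>The entropy of \<open>1 + v\<close> is a mean of \<open>ln (1 + v\<^sub>j) \<le> \<alpha> ln m\<close> with weights \<open>1 + v\<^sub>j\<close>; the maximal value
forces equality wherever the weight is positive.\<close>

lemma extremal_values:
  fixes W :: "(real ^ 'l::finite ^ 'm::finite) set"
  assumes m2: "CARD('m) \<ge> 2" 
    and bound: "\<And>v j. v \<in> M_set W \<Longrightarrow> 1 + v $ j \<le> real CARD('m) powr \<alpha>"
    and ext: "extremal \<alpha> W v a"
  shows "1 + v $ j = 0 \<or> 1 + v $ j = real CARD('m) powr \<alpha>"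
proof (rule ccontr)
  assume neg: "\<not> ?thesis"
  have v: "v \<in> M_set W" using ext by (simp add: extremal_def)
  have le: "(1 + v $ i) * ln (1 + v $ i) \<le> (1 + v $ i) * (\<alpha> * ln (real CARD('m)))" for i
  proof (cases "1 + v $ i = 0")
    case False
    then have "0 < 1 + v $ i" using M_set_nonneg[OF v, of i] by simp
    moreover from this have "ln (1 + v $ i) \<le> \<alpha> * ln (real CARD('m))"
      using bound[OF v, of i] m2 ln_mono[of "1 + v $ i" "real CARD('m) powr \<alpha>"] by (simp add: ln_powr)
    ultimately show ?thesis by (intro mult_left_mono) auto
  qed simp
  have "0 < 1 + v $ j" "1 + v $ j < real CARD('m) powr \<alpha>"
    using M_set_nonneg[OF v, of j] bound[OF v, of j] neg by auto
  then have "ln (1 + v $ j) < ln (real CARD('m) powr \<alpha>)" using m2 by (subst ln_less_cancel_iff) auto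
  then have "(1 + v $ j) * ln (1 + v $ j) < (1 + v $ j) * (\<alpha> * ln (real CARD('m)))"
    using \<open>0 < 1 + v $ j\<close> m2 by (simp add: ln_powr)
  then have "(\<Sum>i\<in>UNIV. (1 + v $ i) * ln (1 + v $ i)) < (\<Sum>i\<in>UNIV. (1 + v $ i) * (\<alpha> * ln (real CARD('m))))"
    using le by (intro sum_strict_mono_ex1) auto
  also have "\<dots> = real CARD('m) * (\<alpha> * ln (real CARD('m)))"
    by (simp only: sum_distrib_right[symmetric] M_set_sum[OF v])
  finally show False
    using ext m2 by (simp add: extremal_def field_simps)
qed

text \<open>The map sending a pair \<open>(x, w)\<close> with \<open>w \<in> W\<close> to the values \<open>x + w\<^sub>j\<close> outside the support has, by
non-locality, the kernel spanned by \<open>(a, v \<otimes> a)\<close>.  On the orthogonal complement of that line in the finite-dimensional space of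
pairs it is injective, hence bounded below.  The approximation by a multiple of \<open>(a, v \<otimes> a)\<close>, rather than
by \<open>v \<otimes> x\<close>, matters because \<open>v \<otimes> x\<close> need not belong to \<open>W\<close>.\<close>

lemma nonlocal_estimate:
  fixes W :: "(real ^ 'l::finite ^ 'm::finite) set"
  assumes sub: "subspace W" and nl: "nonlocal \<alpha> W" and ext: "extremal \<alpha> W v a"
    and H: "ext_support v \<noteq> UNIV"
  shows "\<exists>K>0. \<forall>x. \<forall>w\<in>W. \<exists>c.
    norm (x - c *\<^sub>R a) \<le> K * (\<Sum>j\<in>-ext_support v. norm (x + w $ j)) \<and>
    norm (w - c *\<^sub>R tensor v a) \<le> K * (\<Sum>j\<in>-ext_support v. norm (x + w $ j))"
proof -
  define f :: "(real ^ 'l) \<times> (real ^ 'l ^ 'm) \<Rightarrow> real ^ 'l ^ 'm" where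
    "f = (\<lambda>(x, w). \<chi> j. if j \<in> ext_support v then 0 else x + w $ j)"
  define e where "e = (a, tensor v a)"
  define S where "S = {p. snd p \<in> W \<and> e \<bullet> p = 0}"
  have a0: "a \<noteq> 0" and vW: "tensor v a \<in> W" using ext by (auto simp: extremal_def)
  have e0: "e \<bullet> e > 0" using a0 by (simp only: inner_gt_zero_iff e_def) (simp add: zero_prod_def)
  have lin: "linear f"
    by (rule linearI) (auto simp: f_def vec_eq_iff algebra_simps)
  have S: "subspace S"
    using sub by (auto simp: S_def subspace_def inner_add_right)
  have inj: "p = 0" if "p \<in> S" "f p = 0" for p
  proof -
    obtain x w where p: "p = (x, w)" by (cases p)
    have z: "x + w $ j = 0" if "j \<notin> ext_support v" for j
      using \<open>f p = 0\<close> that by (auto simp: f_def p vec_eq_iff dest!: spec[of _ j])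
    have wW: "w \<in> W" using \<open>p \<in> S\<close> by (simp add: S_def p)
    have "\<exists>c. w = c *\<^sub>R tensor v a"
      using nl[unfolded nonlocal_def, rule_format, OF ext wW] z by metis
    then obtain c where c: "w = c *\<^sub>R tensor v a" ..
    obtain j where j: "j \<notin> ext_support v" using H by auto
    then have "v $ j = -1" by (simp add: ext_support_def)
    then have "x = c *\<^sub>R a" using z[OF j] c by (simp add: tensor_def)
    then have "p = c *\<^sub>R e" by (simp add: p e_def c)
    then show ?thesis using \<open>p \<in> S\<close> e0 by (auto simp: S_def)
  qed
  obtain \<epsilon> where \<epsilon>: "\<epsilon> > 0" "\<And>p. p \<in> S \<Longrightarrow> \<epsilon> * norm p \<le> norm (f p)"
    using injective_imp_isometric[OF closed_subspace[OF S] S _, of f] lin inj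
    by (auto simp: linear_conv_bounded_linear)
  have "\<exists>c. norm (x - c *\<^sub>R a) \<le> 1 / \<epsilon> * (\<Sum>j\<in>-ext_support v. norm (x + w $ j)) \<and>
    norm (w - c *\<^sub>R tensor v a) \<le> 1 / \<epsilon> * (\<Sum>j\<in>-ext_support v. norm (x + w $ j))"
    if w: "w \<in> W" for x w
  proof -
    define c where "c = (e \<bullet> (x, w)) / (e \<bullet> e)"
    define p where "p = (x, w) - c *\<^sub>R e"
    have "e \<bullet> p = 0" using e0 by (simp add: p_def inner_diff_right c_def)
    then have pS: "p \<in> S"
      using sub w vW by (auto simp: S_def p_def e_def intro!: subspace_diff subspace_scale)
    have "f p $ j = (if j \<in> ext_support v then 0 else x + w $ j)" for j
    proof (cases "j \<in> ext_support v")
      case False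
      then have "v $ j = -1" by (simp add: ext_support_def)
      then show ?thesis using False by (simp add: f_def p_def e_def tensor_def)
    qed (simp add: f_def p_def e_def)
    then have "norm (f p) \<le> (\<Sum>j\<in>UNIV. norm (if j \<in> ext_support v then 0 else x + w $ j))"
      using norm_le_sum_norm_nth[of "f p"] by simp
    also have "\<dots> = (\<Sum>j\<in>-ext_support v. norm (x + w $ j))"
      by (intro sum.mono_neutral_cong_right) auto
    finally have "norm p \<le> 1 / \<epsilon> * (\<Sum>j\<in>-ext_support v. norm (x + w $ j))"
      using \<epsilon>(2)[OF pS] \<epsilon>(1) by (simp add: field_simps)
    moreover have "norm (x - c *\<^sub>R a) \<le> norm p" "norm (w - c *\<^sub>R tensor v a) \<le> norm p"
      by (simp_all add: p_def e_def norm_fst_le norm_snd_le)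
    ultimately show ?thesis by (intro exI[of _ c]) linarith
  qed
  then show ?thesis using \<epsilon>(1) by (intro exI[of _ "1/\<epsilon>"]) auto
qed

text \<open>With \<open>z = x + w\<^sub>j\<close>, the combination on the right is, up to the constant \<open>m A\<close>, a sum of terms
\<open>2 A \<bar>z\<bar> - \<bar>z\<bar>\<^sup>2\<close>.  On the support, where
\<open>v \<otimes> x\<close> predicts \<open>z = A x\<close>, Cauchy-Schwarz gives \<open>A\<^sup>2 - \<bar>z - A x\<bar>\<^sup>2\<close> as a lower bound; outside it the
prediction is \<open>z = 0\<close> and the linear term \<open>2 A \<bar>z\<bar>\<close> survives.  So the defects control the mass that leaves
the support to first order, while the deviation from \<open>v \<otimes> x\<close> costs only its square.\<close>

lemma defect_lower_bound:
  fixes w :: "real ^ 'l::finite ^ 'm::finite"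
  assumes vals: "\<And>j. 1 + v $ j = 0 \<or> 1 + v $ j = A" and A: "A > 0"
    and total: "(\<Sum>j\<in>UNIV. 1 + v $ j) = real CARD('m)" and x: "norm x = 1"
  shows "2 * A * (\<Sum>j\<in>-ext_support v. norm (x + w $ j)) - (norm (w - tensor v x))\<^sup>2
    \<le> l2_defect A x w + 2 * A * l1_defect x w"
proof -
  have x2: "x \<bullet> x = 1" using x by (simp add: norm_eq_1)
  have pointwise: "A * (1 + v $ j) + 2 * A * (if j \<in> -ext_support v then norm (x + w $ j) else 0)
      - (norm ((w - tensor v x) $ j))\<^sup>2 \<le> 2 * A * norm (x + w $ j) - (norm (x + w $ j))\<^sup>2" for j
  proof (cases "1 + v $ j = 0")
    case True
    then have "v $ j = -1" by simp
    then show ?thesis by (simp add: ext_support_def tensor_def add.commute)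
  next
    case False
    then have vj: "v $ j = A - 1" using vals[of j] by auto
    define z where "z = x + w $ j"
    have u: "(w - tensor v x) $ j = z - A *\<^sub>R x"
      by (simp add: z_def tensor_def vj algebra_simps)
    have "(norm (z - A *\<^sub>R x))\<^sup>2 = (norm z)\<^sup>2 - 2 * A * (x \<bullet> z) + A\<^sup>2"
      unfolding power2_norm_eq_inner
      by (simp add: inner_diff_left inner_diff_right x2 inner_commute power2_eq_square algebra_simps)
    moreover have "x \<bullet> z \<le> norm z" using norm_cauchy_schwarz[of x z] x by simp
    then have "2 * A * (x \<bullet> z) \<le> 2 * A * norm z" using A by simp
    ultimately show ?thesis
      using False unfolding u z_def[symmetric] by (simp add: ext_support_def vj power2_eq_square)
  qed
  have "(\<Sum>j\<in>UNIV. A * (1 + v $ j) + 2 * A * (if j \<in> -ext_support v then norm (x + w $ j) else 0)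
      - (norm ((w - tensor v x) $ j))\<^sup>2)
    \<le> (\<Sum>j\<in>UNIV. 2 * A * norm (x + w $ j) - (norm (x + w $ j))\<^sup>2)"
    by (rule sum_mono) (rule pointwise)
  then have "A * (\<Sum>j\<in>UNIV. 1 + v $ j)
      + 2 * A * (\<Sum>j\<in>UNIV. if j \<in> -ext_support v then norm (x + w $ j) else 0)
      - (norm (w - tensor v x))\<^sup>2
    \<le> 2 * A * (\<Sum>j\<in>UNIV. norm (x + w $ j)) - (\<Sum>j\<in>UNIV. (norm (x + w $ j))\<^sup>2)"
    unfolding norm_power2_vec[of "w - tensor v x"] sum_subtractf sum_distrib_left
    by (subst (asm) sum.distrib)
  moreover have "(\<Sum>j\<in>UNIV. if j \<in> -ext_support v then norm (x + w $ j) else 0)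
      = (\<Sum>j\<in>-ext_support v. norm (x + w $ j))"
    by (intro sum.mono_neutral_cong_right) auto
  ultimately show ?thesis
    by (simp add: total l1_defect_def l2_defect_def x algebra_simps)
qed

section \<open>The estimate for a single step\<close>

text \<open>Let \<open>s\<close> be the sum of the norms outside the support.  By cancellation \<open>\<phi> w\<close> is \<open>O(s)\<close> on the support, and
outside it the factor \<open>\<bar>x + w\<^sub>j\<bar>\<close> itself is at most \<open>s\<close>, so the left-hand side is \<open>O(s)\<close>.  By
\<open>nonlocal_estimate\<close> the deviation of \<open>w\<close> from \<open>v \<otimes> x\<close> is \<open>O(s)\<close> too, and \<open>defect_lower_bound\<close> bounds the
right-hand side below by \<open>2 A s - O(s\<^sup>2)\<close>.\<close>

lemma near_extremal_estimate:
  fixes W :: "(real ^ 'l::finite ^ 'm::finite) set"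
  assumes sub: "subspace W" and nl: "nonlocal \<alpha> W"
    and phi: "linear_into_V W \<phi>" and canc: "canceling \<alpha> W \<phi>"
    and ext: "extremal \<alpha> W v a"
    and vals: "\<And>j. 1 + v $ j = 0 \<or> 1 + v $ j = A" and A: "A > 1" and R: "R \<ge> 0"
  shows "\<exists>C>0. \<exists>\<delta>>0. \<forall>x. \<forall>w\<in>W. norm x = 1 \<longrightarrow> norm w \<le> R \<longrightarrow>
    (\<Sum>j\<in>-ext_support v. norm (x + w $ j)) < \<delta> \<longrightarrow>
    0 \<le> l2_defect A x w + 2 * A * l1_defect x w \<and>
    (\<Sum>j\<in>UNIV. \<bar>\<phi> w $ j\<bar> * (norm (x + w $ j))\<^sup>2)
      \<le> C * (l2_defect A x w + 2 * A * l1_defect x w)"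
proof -
  define H where "H = ext_support v"
  define s where "s x w = (\<Sum>j\<in>-H. norm (x + w $ j))" for x :: "real ^ 'l" and w :: "real ^ 'l ^ 'm"
  have v: "v \<in> M_set W" and vW: "tensor v a \<in> W" using ext by (auto simp: extremal_def)
  note total = M_set_sum[OF v]
  \<comment> \<open>The support is proper: otherwise the entries \<open>1 + v\<^sub>j = A > 1\<close> could not have mean one.\<close>
  have "H \<noteq> UNIV"
  proof
    assume "H = UNIV"
    then have "1 + v $ j = A" for j using vals[of j] by (auto simp: H_def ext_support_def)
    then show False using total A by simp
  qed
  then obtain K where K: "K > 0" "\<And>x w. w \<in> W \<Longrightarrow> \<exists>c.
    norm (x - c *\<^sub>R a) \<le> K * s x w \<and> norm (w - c *\<^sub>R tensor v a) \<le> K * s x w"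
    using nonlocal_estimate[OF sub nl ext] unfolding H_def s_def by blast
  obtain B where B: "B > 0" "\<And>w j. w \<in> W \<Longrightarrow> \<bar>\<phi> w $ j\<bar> \<le> B * norm w"
    using linear_into_V_bounded[OF sub phi] by blast
  define N where "N = (\<Sum>j\<in>UNIV. \<bar>v $ j\<bar>)"
  \<comment> \<open>\<open>L s\<close> bounds the deviation of \<open>w\<close> from \<open>v \<otimes> x\<close>.\<close>
  define L where "L = K * (1 + N)"
  have N: "N \<ge> 0" by (simp add: N_def sum_nonneg)
  then have L: "L > 0" using K(1) by (simp add: L_def add_pos_nonneg)
  define M where "M = real CARD('m) * (B * K * (1 + R)\<^sup>2) + B * R * (1 + R)"
  have M: "M \<ge> 0" using B(1) K(1) R by (simp add: M_def)
  have main: "0 \<le> l2_defect A x w + 2 * A * l1_defect x w \<and>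
    (\<Sum>j\<in>UNIV. \<bar>\<phi> w $ j\<bar> * (norm (x + w $ j))\<^sup>2)
      \<le> ((M + 1) / A) * (l2_defect A x w + 2 * A * l1_defect x w)"
    if w: "w \<in> W" and x: "norm x = 1" and wR: "norm w \<le> R" and small: "s x w < A / L\<^sup>2" for x w
  proof -
    have s0: "0 \<le> s x w" by (simp add: s_def sum_nonneg)
    obtain c where c: "norm (x - c *\<^sub>R a) \<le> K * s x w" "norm (w - c *\<^sub>R tensor v a) \<le> K * s x w"
      using K(2)[OF w] by blast
    define w' where "w' = w - c *\<^sub>R tensor v a"
    have w'W: "w' \<in> W" using sub w vW by (auto simp: w'_def intro!: subspace_diff subspace_scale)
    have "norm (tensor v (x - c *\<^sub>R a)) \<le> N * norm (x - c *\<^sub>R a)"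
      using norm_le_sum_norm_nth[of "tensor v (x - c *\<^sub>R a)"] by (simp add: tensor_def N_def sum_distrib_right)
    also have "\<dots> \<le> N * (K * s x w)" using c(1) N by (rule mult_left_mono)
    finally have "norm (tensor v (x - c *\<^sub>R a)) \<le> N * (K * s x w)" .
    moreover have "w - tensor v x = w' - tensor v (x - c *\<^sub>R a)"
      by (simp add: w'_def tensor_def vec_eq_iff algebra_simps)
    ultimately have "norm (w - tensor v x) \<le> K * s x w + N * (K * s x w)"
      using c(2)[folded w'_def] by (auto intro: order_trans[OF norm_triangle_ineq4] add_mono)
    then have "norm (w - tensor v x) \<le> L * s x w" by (simp add: L_def algebra_simps)
    \<comment> \<open>For small \<open>s\<close> the quadratic loss uses up at most half of the linear gain \<open>2 A s\<close>.\<close>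
    then have "(norm (w - tensor v x))\<^sup>2 \<le> (L * s x w)\<^sup>2" by (intro power_mono) auto
    also have "\<dots> = (L\<^sup>2 * s x w) * s x w" by (simp add: power2_eq_square)
    also have "\<dots> \<le> A * s x w"
      using small L s0 by (intro mult_right_mono) (auto simp: field_simps)
    finally have "A * s x w \<le> 2 * A * s x w - (norm (w - tensor v x))\<^sup>2" by simp
    also have "\<dots> \<le> l2_defect A x w + 2 * A * l1_defect x w"
      unfolding s_def H_def using vals A total x by (intro defect_lower_bound) auto
    finally have P: "A * s x w \<le> l2_defect A x w + 2 * A * l1_defect x w" .
    have bd: "norm (x + w $ j) \<le> 1 + R" for j
      using norm_triangle_ineq[of x "w $ j"] Finite_Cartesian_Product.norm_nth_le[of w j] x wR by linarith
    have "\<bar>\<phi> w $ j\<bar> * (norm (x + w $ j))\<^sup>2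
      \<le> B * K * (1 + R)\<^sup>2 * s x w + B * R * (1 + R) * (if j \<in> -H then norm (x + w $ j) else 0)" for j
    proof (cases "j \<in> H")
      case True
      \<comment> \<open>Cancellation removes the extremal part, which does belong to \<open>W\<close>.\<close>
      have "\<phi> w = \<phi> (c *\<^sub>R tensor v a + w')" by (simp add: w'_def)
      also have "\<dots> = c *\<^sub>R \<phi> (tensor v a) + \<phi> w'"
        using phi vW w'W sub by (simp add: linear_into_V_def subspace_scale)
      finally have "\<phi> w $ j = \<phi> w' $ j"
        using canc ext True by (simp add: canceling_def H_def)
      then have "\<bar>\<phi> w $ j\<bar> \<le> B * (K * s x w)"
        using B(2)[OF w'W, of j] c(2) B(1) unfolding w'_def[symmetric]
        by (smt (verit) mult_left_mono)
      then have "\<bar>\<phi> w $ j\<bar> * (norm (x + w $ j))\<^sup>2 \<le> B * (K * s x w) * (1 + R)\<^sup>2"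
        using bd[of j] B(1) K(1) s0 by (intro mult_mono power_mono) auto
      then show ?thesis using True by (simp add: mult_ac)
    next
      case False
      have "\<bar>\<phi> w $ j\<bar> \<le> B * R"
        using B(2)[OF w, of j] B(1) wR by (smt (verit) mult_left_mono)
      moreover have "(norm (x + w $ j))\<^sup>2 \<le> (1 + R) * norm (x + w $ j)"
        unfolding power2_eq_square using bd[of j] by (intro mult_right_mono) auto
      ultimately have "\<bar>\<phi> w $ j\<bar> * (norm (x + w $ j))\<^sup>2 \<le> B * R * ((1 + R) * norm (x + w $ j))"
        using B(1) R by (intro mult_mono) auto
      moreover have "0 \<le> B * K * (1 + R)\<^sup>2 * s x w" using B(1) K(1) s0 by simp
      ultimately show ?thesis using False by (simp add: mult_ac)
    qed
    then have "(\<Sum>j\<in>UNIV. \<bar>\<phi> w $ j\<bar> * (norm (x + w $ j))\<^sup>2)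
      \<le> (\<Sum>j\<in>UNIV. B * K * (1 + R)\<^sup>2 * s x w
          + B * R * (1 + R) * (if j \<in> -H then norm (x + w $ j) else 0))"
      by (intro sum_mono)
    also have "\<dots> = real CARD('m) * (B * K * (1 + R)\<^sup>2 * s x w)
        + B * R * (1 + R) * (\<Sum>j\<in>UNIV. if j \<in> -H then norm (x + w $ j) else 0)"
      by (simp only: sum.distrib sum_distrib_left sum_constant)
    also have "(\<Sum>j\<in>UNIV. if j \<in> -H then norm (x + w $ j) else 0) = s x w"
      unfolding s_def by (intro sum.mono_neutral_cong_right) auto
    also have "real CARD('m) * (B * K * (1 + R)\<^sup>2 * s x w) + B * R * (1 + R) * s x w = M * s x w"
      by (simp add: M_def algebra_simps)
    also have "\<dots> \<le> (M + 1) * s x w" using s0 by (intro mult_right_mono) auto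
    also have "\<dots> = ((M + 1) / A) * (A * s x w)" using A by simp
    also have "\<dots> \<le> ((M + 1) / A) * (l2_defect A x w + 2 * A * l1_defect x w)"
      using M A by (intro mult_left_mono[OF P]) auto
    finally show ?thesis using P s0 A by (smt (verit) mult_nonneg_nonneg)
  qed
  show ?thesis
    using main M A L unfolding s_def H_def
    by (intro exI[of _ "(M + 1) / A"] conjI exI[of _ "A / L\<^sup>2"]) auto
qed

text \<open>Equality in the triangle inequality puts all kids on the ray of \<open>x\<close>, so that \<open>w = v \<otimes> x\<close>; a nonpositive
\<open>l2_defect\<close> then leaves only the values \<open>0\<close> and \<open>m\<^sup>\<alpha>\<close> for \<open>1 + v\<^sub>j\<close>, for which the entropy is maximal.\<close>

lemma zero_defect_imp_extremal:
  fixes W :: "(real ^ 'l::finite ^ 'm::finite) set"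
  assumes m2: "CARD('m) \<ge> 2" and WVR: "W \<subseteq> VR_space"
    and bound: "\<And>v j. v \<in> M_set W \<Longrightarrow> 1 + v $ j \<le> real CARD('m) powr \<alpha>"
    and w: "w \<in> W" and x: "norm x = 1"
    and l1: "l1_defect x w = 0" and l2: "l2_defect (real CARD('m) powr \<alpha>) x w \<le> 0"
  shows "\<exists>v. w = tensor v x \<and> extremal \<alpha> W v x"
proof -
  define y where "y j = norm (x + w $ j)" for j
  define v :: "real ^ 'm" where "v = (\<chi> j. y j - 1)"
  have total: "(\<Sum>j\<in>UNIV. y j) = real CARD('m)"
    using l1 x by (simp add: l1_defect_def y_def)
  have x2: "x \<bullet> x = 1" using x by (simp add: norm_eq_1)
  have "(\<Sum>j\<in>UNIV. x \<bullet> (x + w $ j)) = real CARD('m)"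
    using WVR w x2 by (auto simp: VR_space_def inner_add_right sum.distrib simp flip: inner_sum_right)
  then have "(\<Sum>j\<in>UNIV. y j - x \<bullet> (x + w $ j)) = 0" by (simp only: sum_subtractf total diff_self)
  moreover have "0 \<le> y j - x \<bullet> (x + w $ j)" for j
    using norm_cauchy_schwarz[of x "x + w $ j"] x by (simp add: y_def)
  ultimately have "\<forall>j\<in>UNIV. y j - x \<bullet> (x + w $ j) = 0"
    by (subst (asm) sum_nonneg_eq_0_iff) auto
  then have "x \<bullet> (x + w $ j) = norm x * norm (x + w $ j)" for j
    using x by (simp add: y_def)
  then have par: "x + w $ j = y j *\<^sub>R x" for j
    using x norm_cauchy_schwarz_eq[of x "x + w $ j"] by (simp add: y_def)
  have wv: "w = tensor v x"
  proof -
    have "w $ j = (y j - 1) *\<^sub>R x" for j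
      using par[of j] by (simp add: algebra_simps)
    then show ?thesis by (simp add: tensor_def v_def vec_eq_iff)
  qed
  have "(\<Sum>j\<in>UNIV. v $ j) = 0" by (simp add: v_def sum_subtractf total)
  moreover have "-1 \<le> v $ j" for j by (simp add: v_def y_def)
  moreover have "x \<noteq> 0" "tensor v x \<in> W" using x w wv by auto
  ultimately have vM: "v \<in> M_set W" unfolding M_set_def V_space_def by blast
  have yA: "y j \<le> real CARD('m) powr \<alpha>" for j using bound[OF vM, of j] by (simp add: v_def)
  have "(\<Sum>j\<in>UNIV. y j * (real CARD('m) powr \<alpha> - y j)) \<le> 0"
    using l2 x total
    by (simp add: l2_defect_def y_def power2_eq_square algebra_simps sum_subtractf flip: sum_distrib_left)
  moreover have nn: "0 \<le> y j * (real CARD('m) powr \<alpha> - y j)" for j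
    using yA[of j] by (simp add: y_def)
  ultimately have "(\<Sum>j\<in>UNIV. y j * (real CARD('m) powr \<alpha> - y j)) = 0"
    by (meson antisym sum_nonneg)
  then have "\<forall>j\<in>UNIV. y j * (real CARD('m) powr \<alpha> - y j) = 0"
    using nn by (subst (asm) sum_nonneg_eq_0_iff) auto
  then have "y j = 0 \<or> y j = real CARD('m) powr \<alpha>" for j by auto
  moreover have "ln (real CARD('m) powr \<alpha>) = \<alpha> * ln (real CARD('m))" using m2 by (simp add: ln_powr)
  ultimately have ylog: "y j * ln (y j) = y j * (\<alpha> * ln (real CARD('m)))" for j
    by (metis mult_zero_left)
  have "(\<Sum>j\<in>UNIV. (1 + v $ j) * ln (1 + v $ j)) = (\<Sum>j\<in>UNIV. y j * ln (y j))"
    by (simp add: v_def)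
  also have "\<dots> = real CARD('m) * (\<alpha> * ln (real CARD('m)))"
    unfolding ylog by (simp only: sum_distrib_right[symmetric] total)
  finally have "(\<Sum>j\<in>UNIV. (1 + v $ j) * ln (1 + v $ j)) = real CARD('m) * (\<alpha> * ln (real CARD('m)))" .
  then have "extremal \<alpha> W v x"
    using vM \<open>x \<noteq> 0\<close> \<open>tensor v x \<in> W\<close> m2 by (simp add: extremal_def)
  then show ?thesis using wv by blast
qed

text \<open>A compactness argument.  If no constants work, the counterexamples for growing constants accumulate at a pair
where \<open>l1_defect\<close> vanishes and \<open>l2_defect\<close> is nonpositive, that is, at an extremal vector.  There
\<open>near_extremal_estimate\<close> gives the inequality with a fixed constant in a whole neighbourhood.\<close>

lemma local_estimate_sphere:
  fixes W :: "(real ^ 'l::finite ^ 'm::finite) set"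
  assumes m2: "CARD('m) \<ge> 2" and sub: "subspace W" and WVR: "W \<subseteq> VR_space"
    and bound: "\<And>v j. v \<in> M_set W \<Longrightarrow> 1 + v $ j \<le> real CARD('m) powr \<alpha>" and al: "\<alpha> > 0"
    and nl: "nonlocal \<alpha> W" and phi: "linear_into_V W \<phi>" and canc: "canceling \<alpha> W \<phi>"
    and A: "A = real CARD('m) powr \<alpha>" and R: "R \<ge> 0"
  shows "\<exists>C>0. \<exists>C'\<ge>0. \<forall>x. \<forall>w\<in>W. norm x = 1 \<longrightarrow> norm w \<le> R \<longrightarrow>
    (\<Sum>j\<in>UNIV. \<bar>\<phi> w $ j\<bar> * (norm (x + w $ j))\<^sup>2) \<le> C * (l2_defect A x w + C' * l1_defect x w)"
proof (rule ccontr)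
  assume neg: "\<not> ?thesis"
  have A1: "A > 1" using m2 al by (simp add: A gr_one_powr)
  define f where "f z = (\<Sum>j\<in>UNIV. \<bar>\<phi> (snd z) $ j\<bar> * (norm (fst z + snd z $ j))\<^sup>2)"
    for z :: "(real ^ 'l) \<times> (real ^ 'l ^ 'm)"
  define P where "P z = l2_defect A (fst z) (snd z) + 2 * A * l1_defect (fst z) (snd z)"
    for z :: "(real ^ 'l) \<times> (real ^ 'l ^ 'm)"
  define D where "D z = l1_defect (fst z) (snd z)" for z :: "(real ^ 'l) \<times> (real ^ 'l ^ 'm)"
  define S where "S = sphere (0::real ^ 'l) 1 \<times> (W \<inter> cball 0 R)"
  have Ssplit: "norm (fst z) = 1" "snd z \<in> W" "norm (snd z) \<le> R" if "z \<in> S" for z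
    using that by (auto simp: S_def)
  \<comment> \<open>The constants \<open>C = n + 1\<close> and \<open>C' = 2 A + n + 1\<close> fail; the part \<open>2 A\<close> makes \<open>P\<close> appear.\<close>
  have "\<exists>z\<in>S. real (Suc n) * (P z + real (Suc n) * D z) < f z" for n
  proof -
    have "\<exists>x. \<exists>w\<in>W. norm x = 1 \<and> norm w \<le> R \<and>
      real (Suc n) * (l2_defect A x w + (2 * A + real (Suc n)) * l1_defect x w)
        < (\<Sum>j\<in>UNIV. \<bar>\<phi> w $ j\<bar> * (norm (x + w $ j))\<^sup>2)"
    proof -
      have "real (Suc n) > 0" "2 * A + real (Suc n) \<ge> 0" using A1 by auto
      then show ?thesis using neg by (meson not_le)
    qed
    then obtain x w where "w \<in> W" "norm x = 1" "norm w \<le> R"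
      "real (Suc n) * (l2_defect A x w + (2 * A + real (Suc n)) * l1_defect x w)
        < (\<Sum>j\<in>UNIV. \<bar>\<phi> w $ j\<bar> * (norm (x + w $ j))\<^sup>2)" by blast
    then show ?thesis
      by (intro bexI[of _ "(x, w)"]) (auto simp: S_def f_def P_def D_def algebra_simps)
  qed
  then obtain z where z: "\<And>n. z n \<in> S" "\<And>n. real (Suc n) * (P (z n) + real (Suc n) * D (z n)) < f (z n)"
    by metis
  have "compact S"
    unfolding S_def using sub
    by (intro compact_Times closed_Int_compact closed_subspace) auto
  then obtain l r where l: "l \<in> S" and r: "strict_mono r" and lim: "(z \<circ> r) \<longlonglongrightarrow> l"
    using z(1) unfolding compact_def by metis
  have D0: "0 \<le> D u" if "u \<in> S" for u
    using l1_defect_nonneg Ssplit(2)[OF that] WVR by (auto simp: D_def)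
  obtain K where K: "K > 0" "\<And>w j. w \<in> W \<Longrightarrow> \<bar>\<phi> w $ j\<bar> \<le> K * norm w"
    using linear_into_V_bounded[OF sub phi] by blast
  define B where "B = real CARD('m) * (1 + R)\<^sup>2 + real CARD('m) * (K * R * (1 + R)\<^sup>2)"
  have sq: "(norm (fst u + snd u $ j))\<^sup>2 \<le> (1 + R)\<^sup>2" if "u \<in> S" for u j
    using norm_triangle_ineq[of "fst u" "snd u $ j"] Finite_Cartesian_Product.norm_nth_le[of "snd u" j] Ssplit[OF that]
    by (intro power_mono) auto
  have B: "f u - P u \<le> B" "f u \<le> B" if u: "u \<in> S" for u
  proof -
    have fu: "f u \<le> (\<Sum>j\<in>(UNIV::'m set). K * R * (1 + R)\<^sup>2)"
      unfolding f_def
    proof (rule sum_mono)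
      fix j
      have "\<bar>\<phi> (snd u) $ j\<bar> \<le> K * R"
        using K(2)[OF Ssplit(2)[OF u], of j] Ssplit(3)[OF u] K(1) by (smt (verit) mult_left_mono)
      then show "\<bar>\<phi> (snd u) $ j\<bar> * (norm (fst u + snd u $ j))\<^sup>2 \<le> K * R * (1 + R)\<^sup>2"
        using sq[OF u, of j] K(1) R by (intro mult_mono) auto
    qed
    moreover have "(\<Sum>j\<in>UNIV. (norm (fst u + snd u $ j))\<^sup>2) \<le> (\<Sum>j\<in>(UNIV::'m set). (1 + R)\<^sup>2)"
      by (rule sum_mono) (rule sq[OF u])
    moreover have "0 \<le> 2 * A * D u" "0 \<le> real CARD('m) * A" using D0[OF u] A1 by auto
    ultimately show "f u - P u \<le> B"
      using Ssplit(1)[OF u] by (auto simp: P_def l2_defect_def B_def D_def[symmetric])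
    show "f u \<le> B" unfolding B_def using fu by (intro add_increasing) auto
  qed
  have f0: "0 \<le> f u" for u by (simp add: f_def sum_nonneg)
  have Pn: "P (z n) \<le> B * inverse (real (Suc n))" for n
  proof -
    have "real (Suc n) * P (z n) \<le> real (Suc n) * (P (z n) + real (Suc n) * D (z n))"
      using D0[OF z(1)] by (intro mult_left_mono) auto
    then have "real (Suc n) * P (z n) \<le> B" using z(2)[of n] B(2)[OF z(1)[of n]] by linarith
    then show ?thesis by (simp add: field_simps)
  qed
  have Dn: "D (z n) \<le> B * inverse (real (Suc n))" for n
  proof -
    have "P (z n) + real (Suc n) * D (z n) < f (z n)"
    proof (rule ccontr)
      assume "\<not> ?thesis"
      then have "f (z n) \<le> P (z n) + real (Suc n) * D (z n)" by simp
      also have "\<dots> \<le> real (Suc n) * (P (z n) + real (Suc n) * D (z n))"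
        using calculation f0[of "z n"] mult_right_mono[of 1 "real (Suc n)" "P (z n) + real (Suc n) * D (z n)"] by simp
      finally show False using z(2)[of n] by simp
    qed
    then have "real (Suc n) * D (z n) \<le> B" using B(1)[OF z(1)[of n]] by linarith
    then show ?thesis by (simp add: field_simps)
  qed
  have B0: "0 \<le> B" using f0 B(2)[OF l] by (rule order_trans)
  have up: "B * inverse (real (Suc (r n))) \<le> B * inverse (real (Suc n))" for n
    using seq_suble[OF r, of n] B0 by (intro mult_left_mono le_imp_inverse_le) auto
  have null: "(\<lambda>n. B * inverse (real (Suc n))) \<longlonglongrightarrow> 0"
    by (rule tendsto_mult_right_zero) (rule LIMSEQ_inverse_real_of_nat)
  have contD: "continuous_on UNIV D" and contP: "continuous_on UNIV P"
    unfolding D_def P_def l1_defect_def l2_defect_def by (intro continuous_intros)+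
  have limit: "(\<lambda>n. g (z (r n))) \<longlonglongrightarrow> g l" if "continuous_on UNIV g" for g :: "_ \<Rightarrow> real"
    using continuous_on_tendsto_compose[OF that lim] by (simp add: o_def)
  have "D l \<le> 0" "P l \<le> 0"
    using LIMSEQ_le[OF limit[OF contD] null] LIMSEQ_le[OF limit[OF contP] null] Dn Pn up
    by (meson order_trans)+
  then have Dl: "D l = 0" and Ql: "l2_defect A (fst l) (snd l) \<le> 0"
    using D0[OF l] by (auto simp: P_def D_def)
  obtain v where v: "snd l = tensor v (fst l)" and ext: "extremal \<alpha> W v (fst l)"
    using zero_defect_imp_extremal[OF m2 WVR bound Ssplit(2)[OF l] Ssplit(1)[OF l]] Dl Ql
    by (auto simp: D_def A)
  have vals: "1 + v $ j = 0 \<or> 1 + v $ j = A" for j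
    unfolding A by (rule extremal_values[OF m2 bound ext])
  obtain C \<delta> where C: "C > 0" "\<delta> > 0" and near: "\<And>x w. w \<in> W \<Longrightarrow> norm x = 1 \<Longrightarrow> norm w \<le> R \<Longrightarrow>
      (\<Sum>j\<in>-ext_support v. norm (x + w $ j)) < \<delta> \<Longrightarrow>
      0 \<le> l2_defect A x w + 2 * A * l1_defect x w \<and>
      (\<Sum>j\<in>UNIV. \<bar>\<phi> w $ j\<bar> * (norm (x + w $ j))\<^sup>2)
        \<le> C * (l2_defect A x w + 2 * A * l1_defect x w)"
    using near_extremal_estimate[OF sub nl phi canc ext vals A1 R] by blast
  define s where "s u = (\<Sum>j\<in>-ext_support v. norm (fst u + snd u $ j))"
    for u :: "(real ^ 'l) \<times> (real ^ 'l ^ 'm)"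
  have "continuous_on UNIV s" unfolding s_def by (intro continuous_intros)
  then have "(\<lambda>n. s (z (r n))) \<longlonglongrightarrow> s l" by (rule limit)
  moreover have "s l = 0"
    unfolding s_def v by (intro sum.neutral) (auto simp: tensor_def ext_support_def add_eq_0_iff)
  ultimately have "eventually (\<lambda>n. s (z (r n)) < \<delta>) sequentially"
    using C(2) by (auto intro: order_tendstoD(2))
  moreover have "eventually (\<lambda>n. C \<le> real n) sequentially"
    using filterlim_real_sequentially by (auto simp: filterlim_at_top)
  ultimately have "eventually (\<lambda>n. s (z (r n)) < \<delta> \<and> C \<le> real n) sequentially"
    by eventually_elim auto
  then obtain n where n: "s (z (r n)) < \<delta>" "C \<le> real n"
    using eventually_happens by force
  define u where "u = z (r n)"
  have u: "u \<in> S" using z(1) by (simp add: u_def)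
  have P: "0 \<le> P u" "f u \<le> C * P u"
    using near[OF Ssplit(2)[OF u] Ssplit(1)[OF u] Ssplit(3)[OF u]] n(1)
    by (auto simp: P_def f_def s_def u_def)
  have "C * P u \<le> real (Suc (r n)) * P u"
    using n(2) seq_suble[OF r, of n] by (intro mult_right_mono[OF _ P(1)]) simp
  also have "\<dots> \<le> real (Suc (r n)) * (P u + real (Suc (r n)) * D u)"
    using D0[OF u] by (intro mult_left_mono) auto
  also have "\<dots> < f u" using z(2)[of "r n"] by (simp add: u_def)
  finally show False using P(2) by simp
qed

section \<open>The Bellman inequality\<close>

text \<open>Completing the square in \<open>\<rho>\<close> with coefficient \<open>A - \<epsilon> p\<close>; the assumption \<open>2 \<epsilon> p \<le> A\<close> allows
\<open>1 / (A - \<epsilon> p) \<le> 1 / A + 2 \<epsilon> p / A\<^sup>2\<close>.\<close>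

lemma young_kid:
  fixes p A \<epsilon> y \<rho> :: real
  assumes "A > 0" "\<epsilon> \<ge> 0" "p \<ge> 0" "2 * \<epsilon> * p \<le> A"
  shows "\<epsilon> * p * \<rho>\<^sup>2 + 2 * y * \<rho> \<le> A * \<rho>\<^sup>2 + y\<^sup>2 / A + 2 * \<epsilon> * p * y\<^sup>2 / A\<^sup>2"
proof -
  define q where "q = A - \<epsilon> * p"
  have q: "q > 0" "2 * \<epsilon> * p \<le> A" using assms by (auto simp: q_def)
  have "1 / q \<le> 1 / A + 2 * \<epsilon> * p / A\<^sup>2"
  proof -
    have "A\<^sup>2 \<le> A\<^sup>2 + \<epsilon> * p * (A - 2 * \<epsilon> * p)" using assms by simp
    also have "\<dots> = (A + 2 * \<epsilon> * p) * q" by (simp add: q_def power2_eq_square algebra_simps)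
    finally have "1 \<le> (A + 2 * \<epsilon> * p) * q / A\<^sup>2" using assms(1) by (simp add: field_simps)
    then show ?thesis using q(1) assms(1) by (simp add: field_simps power2_eq_square)
  qed
  then have "y\<^sup>2 * (1 / q) \<le> y\<^sup>2 * (1 / A + 2 * \<epsilon> * p / A\<^sup>2)" by (rule mult_left_mono) simp
  moreover have "2 * y * \<rho> \<le> q * \<rho>\<^sup>2 + y\<^sup>2 * (1 / q)"
  proof -
    have "0 \<le> (q * \<rho> - y)\<^sup>2 / q" using q(1) by simp
    also have "\<dots> = q * \<rho>\<^sup>2 + y\<^sup>2 * (1 / q) - 2 * y * \<rho>"
      using q(1) by (simp add: power2_eq_square field_simps)
    finally show ?thesis by simp
  qed
  ultimately show ?thesis by (simp add: q_def algebra_simps)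
qed

text \<open>One step of the Bellman function \<open>C1 \<bar>x\<bar> - C2 \<bar>x\<bar> \<surd>t\<close>, where \<open>x\<close> is the value of the martingale on an atom and
\<open>t \<in> [0, 1]\<close> the normalized mass that the measure gives it; \<open>\<tau>\<close> and \<open>r\<^sub>j\<close> are the square roots of \<open>t\<close> for
the parent and for its kids, and the relation between them is additivity of the measure.  The square root is concave and
homogeneous: a step that neither raises the mean of the norm nor is extremal gains a multiple of \<open>\<bar>x\<bar> \<surd>t\<close>, which
pays for a contribution of order \<open>\<bar>x\<bar> t\<close> even for small \<open>t\<close>, where a gain quadratic in \<open>t\<close> would not.  By the
same homogeneity the inequality reduces to \<open>\<bar>x\<bar> = 1\<close> and \<open>\<tau> = 1\<close>, unless \<open>w\<close> is large compared with \<open>x\<close>.\<close>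

lemma bellman_inequality:
  fixes W :: "(real ^ 'l::finite ^ 'm::finite) set"
  assumes m2: "CARD('m) \<ge> 2" and sub: "subspace W" and WVR: "W \<subseteq> VR_space"
    and bound: "\<And>v j. v \<in> M_set W \<Longrightarrow> 1 + v $ j \<le> real CARD('m) powr \<alpha>" and al: "\<alpha> > 0"
    and nl: "nonlocal \<alpha> W" and phi: "linear_into_V W \<phi>" and canc: "canceling \<alpha> W \<phi>"
    and A: "A = real CARD('m) powr \<alpha>"
  shows "\<exists>C1\<ge>0. \<exists>C2\<ge>0. \<forall>x. \<forall>w\<in>W. \<forall>r \<tau>. 0 \<le> \<tau> \<longrightarrow> \<tau> \<le> 1 \<longrightarrow> (\<forall>j. 0 \<le> r j) \<longrightarrow>
    (\<Sum>j\<in>UNIV. (r j)\<^sup>2) = real CARD('m) / A * \<tau>\<^sup>2 \<longrightarrow>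
    (\<Sum>j\<in>UNIV. \<bar>\<phi> w $ j\<bar> * (r j)\<^sup>2)
      \<le> C1 * l1_defect x w + C2 * (real CARD('m) * \<tau> * norm x - (\<Sum>j\<in>UNIV. norm (x + w $ j) * r j))"
proof -
  define m where "m = real CARD('m)"
  have m: "m \<ge> 2" using m2 by (simp add: m_def)
  have A1: "A > 1" using m2 al by (simp add: A gr_one_powr)
  \<comment> \<open>Once \<open>\<bar>w\<bar> > 4 m \<bar>x\<bar>\<close>, \<open>l1_defect x w\<close> is at least \<open>\<bar>w\<bar> / 2\<close> and dominates all other terms.\<close>
  define R where "R = 4 * m"
  have R: "R \<ge> 0" using m by (simp add: R_def)
  obtain K where K: "K > 0" "\<And>w j. w \<in> W \<Longrightarrow> \<bar>\<phi> w $ j\<bar> \<le> K * norm w"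
    using linear_into_V_bounded[OF sub phi] by blast
  obtain C0 C' where C0: "C0 > 0" "C' \<ge> 0" and sphere: "\<And>x w. w \<in> W \<Longrightarrow> norm x = 1 \<Longrightarrow> norm w \<le> R \<Longrightarrow>
    (\<Sum>j\<in>UNIV. \<bar>\<phi> w $ j\<bar> * (norm (x + w $ j))\<^sup>2) \<le> C0 * (l2_defect A x w + C' * l1_defect x w)"
    using local_estimate_sphere[OF m2 sub WVR bound al nl phi canc A R] by blast
  \<comment> \<open>The sphere estimate persists for a larger \<open>C\<close>, since its left-hand side is nonnegative; \<open>C \<ge> K R\<close> bounds every \<open>\<bar>\<phi> w\<^sub>j\<bar>\<close>.\<close>
  define C where "C = max C0 (K * R)"
  have C: "C > 0" using C0(1) by (simp add: C_def)
  define c2 where "c2 = 4 * C / A"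
  define c1 where "c1 = 2 * C * C' / A\<^sup>2"
  have c: "c1 \<ge> 0" "c2 \<ge> 0" using C C0 A1 by (auto simp: c1_def c2_def)
  have norm1: "(\<Sum>j\<in>UNIV. \<bar>\<phi> w $ j\<bar> * (\<rho> j)\<^sup>2)
      \<le> c1 * l1_defect x w + c2 * (m - (\<Sum>j\<in>UNIV. norm (x + w $ j) * \<rho> j))"
    if w: "w \<in> W" and x: "norm x = 1" and wR: "norm w \<le> R" and \<rho>: "(\<Sum>j\<in>UNIV. (\<rho> j)\<^sup>2) = m / A"
    for x w \<rho>
  proof -
    define p where "p j = \<bar>\<phi> w $ j\<bar>" for j
    define y where "y j = norm (x + w $ j)" for j
    define Q where "Q = l2_defect A x w"
    define D where "D = l1_defect x w"
    have p: "p j \<le> C" "0 \<le> p j" for j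
    proof -
      have "p j \<le> K * R" using K(2)[OF w, of j] K(1) wR unfolding p_def by (smt (verit) mult_left_mono)
      then show "p j \<le> C" by (simp add: C_def)
    qed (simp add: p_def)
    have le: "(\<Sum>j\<in>UNIV. p j * (y j)\<^sup>2) \<le> C * (Q + C' * D)"
    proof -
      have *: "(\<Sum>j\<in>UNIV. p j * (y j)\<^sup>2) \<le> C0 * (Q + C' * D)"
        using sphere[OF w x wR] by (simp add: p_def y_def Q_def D_def)
      moreover have "0 \<le> (\<Sum>j\<in>UNIV. p j * (y j)\<^sup>2)" using p by (intro sum_nonneg) auto
      ultimately have "0 \<le> C0 * (Q + C' * D)" by linarith
      then have "0 \<le> Q + C' * D" using C0(1) by (simp add: zero_le_mult_iff)
      then have "C0 * (Q + C' * D) \<le> C * (Q + C' * D)" by (intro mult_right_mono) (auto simp: C_def)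
      then show ?thesis using * by linarith
    qed
    \<comment> \<open>With this \<open>\<epsilon>\<close> the two occurrences of \<open>Q / A\<close> below cancel.\<close>
    define \<epsilon> where "\<epsilon> = A / (2 * C)"
    have "\<epsilon> * p j * (\<rho> j)\<^sup>2 + 2 * y j * \<rho> j \<le> A * (\<rho> j)\<^sup>2 + (y j)\<^sup>2 / A + 2 * \<epsilon> * p j * (y j)\<^sup>2 / A\<^sup>2" for j
    proof (rule young_kid)
      show "2 * \<epsilon> * p j \<le> A" using p[of j] C A1 by (simp add: \<epsilon>_def field_simps)
    qed (use A1 C p in \<open>auto simp: \<epsilon>_def\<close>)
    then have young: "(\<Sum>j\<in>UNIV. \<epsilon> * p j * (\<rho> j)\<^sup>2 + 2 * y j * \<rho> j)
      \<le> (\<Sum>j\<in>UNIV. A * (\<rho> j)\<^sup>2 + (y j)\<^sup>2 / A + 2 * \<epsilon> * p j * (y j)\<^sup>2 / A\<^sup>2)"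
      by (rule sum_mono)
    have e1: "(\<Sum>j\<in>UNIV. \<epsilon> * p j * (\<rho> j)\<^sup>2 + 2 * y j * \<rho> j)
        = \<epsilon> * (\<Sum>j\<in>UNIV. p j * (\<rho> j)\<^sup>2) + 2 * (\<Sum>j\<in>UNIV. y j * \<rho> j)"
      by (simp add: sum.distrib sum_distrib_left mult.assoc)
    have e2: "(\<Sum>j\<in>UNIV. A * (\<rho> j)\<^sup>2 + (y j)\<^sup>2 / A + 2 * \<epsilon> * p j * (y j)\<^sup>2 / A\<^sup>2)
        = A * (\<Sum>j\<in>UNIV. (\<rho> j)\<^sup>2) + (\<Sum>j\<in>UNIV. (y j)\<^sup>2) / A + 2 * \<epsilon> / A\<^sup>2 * (\<Sum>j\<in>UNIV. p j * (y j)\<^sup>2)"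
      by (simp add: sum.distrib sum_distrib_left sum_divide_distrib mult.assoc)
    have e3: "A * (\<Sum>j\<in>UNIV. (\<rho> j)\<^sup>2) = m" using A1 \<rho> by simp
    have e4: "(\<Sum>j\<in>UNIV. (y j)\<^sup>2) / A = m - Q / A"
      using A1 x by (simp add: Q_def l2_defect_def y_def m_def diff_divide_distrib)
    have "\<epsilon> * (\<Sum>j\<in>UNIV. p j * (\<rho> j)\<^sup>2) + 2 * (\<Sum>j\<in>UNIV. y j * \<rho> j)
        \<le> m + (m - Q / A) + 2 * \<epsilon> / A\<^sup>2 * (\<Sum>j\<in>UNIV. p j * (y j)\<^sup>2)"
      using young by (simp only: e1 e2 e3 e4)
    also have "2 * \<epsilon> / A\<^sup>2 * (\<Sum>j\<in>UNIV. p j * (y j)\<^sup>2) \<le> 2 * \<epsilon> / A\<^sup>2 * (C * (Q + C' * D))"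
      using le A1 C by (intro mult_left_mono) (auto simp: \<epsilon>_def)
    also have "2 * \<epsilon> / A\<^sup>2 * (C * (Q + C' * D)) = Q / A + C' / A * D"
      using A1 C by (simp add: \<epsilon>_def field_simps power2_eq_square)
    finally have "\<epsilon> * (\<Sum>j\<in>UNIV. p j * (\<rho> j)\<^sup>2) \<le> 2 * (m - (\<Sum>j\<in>UNIV. y j * \<rho> j)) + C' / A * D"
      by (simp add: right_diff_distrib)
    then have "(2 * C / A) * (\<epsilon> * (\<Sum>j\<in>UNIV. p j * (\<rho> j)\<^sup>2))
      \<le> (2 * C / A) * (2 * (m - (\<Sum>j\<in>UNIV. y j * \<rho> j)) + C' / A * D)"
      using C A1 by (intro mult_left_mono) auto
    moreover have "(2 * C / A) * (\<epsilon> * (\<Sum>j\<in>UNIV. p j * (\<rho> j)\<^sup>2)) = (\<Sum>j\<in>UNIV. p j * (\<rho> j)\<^sup>2)"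
      using C A1 by (simp add: \<epsilon>_def)
    moreover have "(2 * C / A) * (2 * (m - (\<Sum>j\<in>UNIV. y j * \<rho> j)) + C' / A * D)
        = c1 * D + c2 * (m - (\<Sum>j\<in>UNIV. y j * \<rho> j))"
      by (simp add: c1_def c2_def power2_eq_square algebra_simps)
    ultimately show ?thesis by (simp add: p_def y_def D_def)
  qed
  define C1 where "C1 = c1 + 2 * K * m + 4 * c2 * m\<^sup>2"
  have C1: "C1 \<ge> c1" "C1 \<ge> 0" using c K(1) m by (auto simp: C1_def)
  have "(\<Sum>j\<in>UNIV. \<bar>\<phi> w $ j\<bar> * (r j)\<^sup>2)
      \<le> C1 * l1_defect x w + c2 * (m * \<tau> * norm x - (\<Sum>j\<in>UNIV. norm (x + w $ j) * r j))"
    if w: "w \<in> W" and \<tau>: "0 \<le> \<tau>" "\<tau> \<le> 1" and r: "\<And>j. 0 \<le> r j"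
      and sumr: "(\<Sum>j\<in>UNIV. (r j)\<^sup>2) = m / A * \<tau>\<^sup>2" for x w r \<tau>
  proof -
    have D0: "0 \<le> l1_defect x w" using w WVR by (intro l1_defect_nonneg) auto
    consider "\<tau> = 0" | "R * norm x < norm w" | "\<tau> > 0" "x \<noteq> 0" "norm w \<le> R * norm x" | "x = 0" "w = 0"
      using \<tau>(1) by fastforce
    then show ?thesis
    proof cases
      case 1
      then have "(\<Sum>j\<in>UNIV. (r j)\<^sup>2) = 0" using sumr by simp
      then have "r j = 0" for j by (subst (asm) sum_nonneg_eq_0_iff) auto
      then show ?thesis using 1 D0 C1 by simp
    next
      case 4
      then have "\<phi> w = 0" using linear_into_V_zero[OF sub phi] by simp
      then show ?thesis using 4 by (simp add: l1_defect_def)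
    next
      case 2
      then have x4: "norm x * (4 * m) \<le> norm w" by (simp add: R_def mult.commute)
      have xw: "norm x \<le> norm w"
        using x4 m mult_left_mono[of 1 "4 * m" "norm x"] by simp
      have mA: "m / A * \<tau>\<^sup>2 \<le> m"
      proof -
        have "m / A \<le> m" using m A1 by (simp add: field_simps)
        moreover have "\<tau>\<^sup>2 \<le> 1" using \<tau> by (simp add: power_le_one)
        ultimately show ?thesis using m A1 mult_mono[of "m/A" m "\<tau>\<^sup>2" 1] by simp
      qed
      have rm: "r j \<le> m" for j
      proof -
        have "(r j)\<^sup>2 \<le> (\<Sum>j\<in>UNIV. (r j)\<^sup>2)" by (rule member_le_sum) auto
        also have "\<dots> \<le> m" unfolding sumr by (rule mA)
        also have "\<dots> \<le> m\<^sup>2" using m by (simp add: power2_eq_square)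
        finally show ?thesis using m r by (simp add: power2_le_iff_abs_le)
      qed
      have "(\<Sum>j\<in>UNIV. \<bar>\<phi> w $ j\<bar> * (r j)\<^sup>2) \<le> (\<Sum>j\<in>UNIV. K * norm w * (r j)\<^sup>2)"
        by (intro sum_mono mult_right_mono K(2) w) auto
      also have "\<dots> = K * norm w * (m / A * \<tau>\<^sup>2)" by (simp add: sum_distrib_left[symmetric] sumr)
      also have "\<dots> \<le> K * norm w * m" using mA K(1) by (intro mult_left_mono) auto
      finally have lhs: "(\<Sum>j\<in>UNIV. \<bar>\<phi> w $ j\<bar> * (r j)\<^sup>2) \<le> K * norm w * m" .
      have "(\<Sum>j\<in>UNIV. norm (x + w $ j) * r j) \<le> (\<Sum>j\<in>(UNIV::'m set). 2 * norm w * m)"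
      proof (intro sum_mono mult_mono rm r)
        fix j show "norm (x + w $ j) \<le> 2 * norm w"
          using norm_triangle_ineq[of x "w $ j"] Finite_Cartesian_Product.norm_nth_le[of w j] xw by linarith
      qed auto
      then have "(\<Sum>j\<in>UNIV. norm (x + w $ j) * r j) \<le> 2 * norm w * m\<^sup>2"
        by (simp add: m_def power2_eq_square mult_ac)
      moreover have "0 \<le> m * \<tau> * norm x" using m \<tau> by simp
      ultimately have "c2 * (- (2 * norm w * m\<^sup>2)) \<le> c2 * (m * \<tau> * norm x - (\<Sum>j\<in>UNIV. norm (x + w $ j) * r j))"
        using c by (intro mult_left_mono) auto
      moreover have "C1 * (norm w / 2) \<le> C1 * l1_defect x w"
      proof (intro mult_left_mono C1(2))
        have "norm w \<le> (\<Sum>j\<in>UNIV. norm (w $ j))" by (rule norm_le_sum_norm_nth)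
        also have "\<dots> \<le> (\<Sum>j\<in>UNIV. norm (x + w $ j) + norm x)"
        proof (rule sum_mono)
          fix j show "norm (w $ j) \<le> norm (x + w $ j) + norm x"
            using norm_triangle_ineq4[of "x + w $ j" x] by simp
        qed
        also have "\<dots> = (\<Sum>j\<in>UNIV. norm (x + w $ j)) + m * norm x" by (simp add: sum.distrib m_def)
        finally show "norm w / 2 \<le> l1_defect x w"
          using x4 by (simp add: l1_defect_def m_def[symmetric] algebra_simps)
      qed
      moreover have "C1 * (norm w / 2) = c1 * norm w / 2 + K * norm w * m + 2 * c2 * m\<^sup>2 * norm w"
        by (simp add: C1_def algebra_simps)
      moreover have "0 \<le> c1 * norm w / 2" using c by simp
      ultimately show ?thesis using lhs by (simp add: algebra_simps)
    next
      case 3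
      define n where "n = norm x"
      have n: "n > 0" using 3 by (simp add: n_def)
      define x' where "x' = inverse n *\<^sub>R x"
      define w' where "w' = inverse n *\<^sub>R w"
      define \<rho> where "\<rho> j = r j / \<tau>" for j
      have w'W: "w' \<in> W" using sub w by (simp add: w'_def subspace_scale)
      have x'1: "norm x' = 1" using n by (simp add: x'_def n_def)
      have w'R: "norm w' \<le> R" using n 3(3) by (simp add: w'_def n_def field_simps)
      have "(\<Sum>j\<in>UNIV. (\<rho> j)\<^sup>2) = (\<Sum>j\<in>UNIV. (r j)\<^sup>2) / \<tau>\<^sup>2"
        by (simp add: \<rho>_def power_divide sum_divide_distrib)
      then have \<rho>: "(\<Sum>j\<in>UNIV. (\<rho> j)\<^sup>2) = m / A" using sumr 3(1) by simp
      have y: "norm (x' + w' $ j) = inverse n * norm (x + w $ j)" for j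
      proof -
        have "x' + w' $ j = inverse n *\<^sub>R (x + w $ j)" by (simp add: x'_def w'_def algebra_simps)
        then show ?thesis using n by (simp only: norm_scaleR) simp
      qed
      have p: "\<bar>\<phi> w' $ j\<bar> = inverse n * \<bar>\<phi> w $ j\<bar>" for j
        using phi w n by (simp add: linear_into_V_def w'_def abs_mult)
      have D: "l1_defect x' w' = inverse n * l1_defect x w"
        using n x'1 by (simp add: l1_defect_def y sum_distrib_left[symmetric] right_diff_distrib n_def)
      \<comment> \<open>Scaling back by \<open>n \<tau>\<close> divides the left-hand side by \<open>\<tau> \<le> 1\<close>, which only strengthens the bound.\<close>
      have "(n * \<tau>) * (\<Sum>j\<in>UNIV. \<bar>\<phi> w' $ j\<bar> * (\<rho> j)\<^sup>2)
        \<le> (n * \<tau>) * (c1 * l1_defect x' w' + c2 * (m - (\<Sum>j\<in>UNIV. norm (x' + w' $ j) * \<rho> j)))"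
        using n 3(1) norm1[OF w'W x'1 w'R \<rho>] by (intro mult_left_mono) auto
      also have "(n * \<tau>) * (\<Sum>j\<in>UNIV. \<bar>\<phi> w' $ j\<bar> * (\<rho> j)\<^sup>2) = (\<Sum>j\<in>UNIV. \<bar>\<phi> w $ j\<bar> * (r j)\<^sup>2) / \<tau>"
        unfolding p \<rho>_def sum_distrib_left sum_divide_distrib
        using n 3(1) by (intro sum.cong) (auto simp: field_simps power2_eq_square)
      also have "(n * \<tau>) * (c1 * l1_defect x' w' + c2 * (m - (\<Sum>j\<in>UNIV. norm (x' + w' $ j) * \<rho> j)))
        = \<tau> * (c1 * l1_defect x w) + c2 * (m * \<tau> * n - (n * \<tau>) * (\<Sum>j\<in>UNIV. norm (x' + w' $ j) * \<rho> j))"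
        using n by (simp add: D algebra_simps)
      also have "(n * \<tau>) * (\<Sum>j\<in>UNIV. norm (x' + w' $ j) * \<rho> j) = (\<Sum>j\<in>UNIV. norm (x + w $ j) * r j)"
        unfolding y \<rho>_def sum_distrib_left
        using n 3(1) by (intro sum.cong) (auto simp: field_simps)
      finally have "(\<Sum>j\<in>UNIV. \<bar>\<phi> w $ j\<bar> * (r j)\<^sup>2) / \<tau>
        \<le> \<tau> * (c1 * l1_defect x w) + c2 * (m * \<tau> * n - (\<Sum>j\<in>UNIV. norm (x + w $ j) * r j))" .
      moreover have "(\<Sum>j\<in>UNIV. \<bar>\<phi> w $ j\<bar> * (r j)\<^sup>2) \<le> (\<Sum>j\<in>UNIV. \<bar>\<phi> w $ j\<bar> * (r j)\<^sup>2) / \<tau>"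
      proof -
        have "0 \<le> (\<Sum>j\<in>UNIV. \<bar>\<phi> w $ j\<bar> * (r j)\<^sup>2)" by (intro sum_nonneg) auto
        then show ?thesis using 3(1) \<tau>(2) mult_left_mono[of \<tau> 1 "\<Sum>j\<in>UNIV. \<bar>\<phi> w $ j\<bar> * (r j)\<^sup>2"]
          by (simp add: field_simps)
      qed
      moreover have "\<tau> * (c1 * l1_defect x w) \<le> C1 * l1_defect x w"
      proof -
        have "\<tau> * (c1 * l1_defect x w) \<le> 1 * (c1 * l1_defect x w)"
          using \<tau> c D0 by (intro mult_right_mono) auto
        also have "\<dots> \<le> C1 * l1_defect x w" using C1 D0 by (simp add: mult_right_mono)
        finally show ?thesis .
      qed
      ultimately show ?thesis unfolding n_def by linarith
    qed
  qed
  then show ?thesis using C1(2) c(2) unfolding m_def by blast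
qed

section \<open>Atoms, kids and adapted functions\<close>

definition atom_value :: "('a \<Rightarrow> 'b) \<Rightarrow> 'a set \<Rightarrow> 'b" where
  "atom_value f \<omega> = the_elem (f ` \<omega>)"

lemma atom_memE:
  assumes "\<omega> \<in> atoms n"
  obtains p where "\<omega> = cylinder n p" "p \<in> \<omega>"
  using assms by (auto simp: atoms_def cylinder_def)

lemma kid_cylinder: "kid n (cylinder n p) j = cylinder (Suc n) (p(n := j))"
  by (auto simp: kid_def cylinder_def less_Suc_eq)

lemma kid_in_atoms:
  assumes "\<omega> \<in> atoms n"
  shows "kid n \<omega> j \<in> atoms (Suc n)"
  using assms by (auto simp: atoms_def kid_cylinder)

lemma kid_nonempty:
  assumes "\<omega> \<in> atoms n"
  shows "kid n \<omega> j \<noteq> {}"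
  using kid_in_atoms[OF assms] by (auto elim: atom_memE)

lemma cylinder_unique: "\<gamma> \<in> cylinder n p \<Longrightarrow> cylinder n p = cylinder n \<gamma>"
  by (auto simp: cylinder_def)

lemma atom_eq_cylinder: "\<omega> \<in> atoms n \<Longrightarrow> \<gamma> \<in> \<omega> \<Longrightarrow> \<omega> = cylinder n \<gamma>"
  by (auto simp: atoms_def dest: cylinder_unique)

lemma atoms_Suc_bij: "bij_betw (\<lambda>(\<omega>, j). kid n \<omega> j) (atoms n \<times> (UNIV :: 'm::finite set)) (atoms (Suc n))"
  unfolding bij_betw_def
proof
  show "inj_on (\<lambda>(\<omega>, j). kid n \<omega> j) (atoms n \<times> (UNIV :: 'm set))"
  proof (rule inj_onI, clarify)
    fix \<omega> \<omega>' and i j :: 'm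
    assume *: "\<omega> \<in> atoms n" "\<omega>' \<in> atoms n" "kid n \<omega> i = kid n \<omega>' j"
    obtain \<gamma> where "\<gamma> \<in> kid n \<omega> i" using kid_nonempty[OF *(1)] by blast
    then have "\<gamma> \<in> \<omega>" "\<gamma> \<in> \<omega>'" "\<gamma> n = i" "\<gamma> n = j" using *(3) by (auto simp: kid_def)
    then show "\<omega> = \<omega>' \<and> i = j" using atom_eq_cylinder *(1,2) by metis
  qed
  show "(\<lambda>(\<omega>, j). kid n \<omega> j) ` (atoms n \<times> (UNIV :: 'm set)) = atoms (Suc n)"
  proof
    show "atoms (Suc n) \<subseteq> (\<lambda>(\<omega>, j). kid n \<omega> j) ` (atoms n \<times> (UNIV :: 'm set))"
    proof
      fix \<omega> :: "(nat \<Rightarrow> 'm) set" assume "\<omega> \<in> atoms (Suc n)"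
      then obtain p where "\<omega> = cylinder (Suc n) p" by (auto simp: atoms_def)
      then have "\<omega> = kid n (cylinder n p) (p n)" by (simp add: kid_cylinder)
      then show "\<omega> \<in> (\<lambda>(\<omega>, j). kid n \<omega> j) ` (atoms n \<times> UNIV)"
        by (intro image_eqI[of _ _ "(cylinder n p, p n)"]) (auto simp: atoms_def)
    qed
  qed (auto intro: kid_in_atoms)
qed

lemma sum_atoms_Suc:
  fixes g :: "(nat \<Rightarrow> 'm::finite) set \<Rightarrow> real"
  shows "(\<Sum>\<omega>\<in>atoms (Suc n). g \<omega>) = (\<Sum>\<omega>\<in>atoms n. \<Sum>j\<in>UNIV. g (kid n \<omega> j))"
  using sum.reindex_bij_betw[OF atoms_Suc_bij, of g n]
  by (simp add: sum.cartesian_product split_beta)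

text \<open>Every set of the generated algebra is saturated for agreement of the first \<open>n\<close> digits, by induction on its generation.\<close>

lemma level_measurable_const:
  fixes f :: "(nat \<Rightarrow> 'm::finite) \<Rightarrow> 'b::{t1_space}"
  assumes f: "f \<in> borel_measurable (level_algebra n)" and \<omega>: "\<omega> \<in> atoms n" "\<gamma> \<in> \<omega>" "\<gamma>' \<in> \<omega>"
  shows "f \<gamma> = f \<gamma>'"
proof -
  have sat: "p \<in> A \<longleftrightarrow> q \<in> A" if "A \<in> sigma_sets UNIV (atoms n)" "\<forall>i<n. p i = q i" for A and p q :: "nat \<Rightarrow> 'm"
    using that
  proof (induction rule: sigma_sets.induct)
    case (Basic a)
    then show ?case by (auto simp: atoms_def cylinder_def)
  qed auto
  have "f -` {f \<gamma>} \<inter> space (level_algebra n) \<in> sets (level_algebra n)"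
    by (rule measurable_sets[OF f]) (auto intro: borel_closed)
  then have "f -` {f \<gamma>} \<in> sigma_sets UNIV (atoms n)"
    by (simp add: level_algebra_def)
  moreover have "\<forall>i<n. \<gamma> i = \<gamma>' i" using \<omega> by (auto simp: atoms_def cylinder_def)
  ultimately have "\<gamma>' \<in> f -` {f \<gamma>}" using sat by blast
  then show ?thesis by simp
qed

lemma atom_value_eq:
  fixes f :: "(nat \<Rightarrow> 'm::finite) \<Rightarrow> 'b::{t1_space}"
  assumes "f \<in> borel_measurable (level_algebra n)" "\<omega> \<in> atoms n" "\<gamma> \<in> \<omega>"
  shows "atom_value f \<omega> = f \<gamma>"
  unfolding atom_value_def
proof (rule the_elem_image_unique)
  show "\<omega> \<noteq> {}" using assms(3) by blast
  fix \<gamma>' assume "\<gamma>' \<in> \<omega>"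
  then show "f \<gamma>' = f \<gamma>" by (rule level_measurable_const[OF assms(1,2) _ assms(3)])
qed

lemma diff_string_nth:
  fixes F :: "nat \<Rightarrow> (nat \<Rightarrow> 'm::finite) \<Rightarrow> real ^ 'l::finite"
  assumes F: "\<And>n. F n \<in> borel_measurable (level_algebra n)" and \<omega>: "\<omega> \<in> atoms n"
  shows "diff_string F n \<omega> $ j = atom_value (F (Suc n)) (kid n \<omega> j) - atom_value (F n) \<omega>"
proof -
  obtain \<gamma> where \<gamma>: "\<gamma> \<in> kid n \<omega> j" using kid_nonempty[OF \<omega>] by blast
  have sub: "kid n \<omega> j \<subseteq> \<omega>" by (auto simp: kid_def)
  have val: "F (Suc n) \<gamma>' - F n \<gamma>' = atom_value (F (Suc n)) (kid n \<omega> j) - atom_value (F n) \<omega>"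
    if "\<gamma>' \<in> kid n \<omega> j" for \<gamma>'
    using atom_value_eq[OF F \<omega>, of \<gamma>'] atom_value_eq[OF F kid_in_atoms[OF \<omega>] that] that sub
    by (simp add: subset_iff)
  have "the_elem ((\<lambda>\<gamma>. F (Suc n) \<gamma> - F n \<gamma>) ` kid n \<omega> j) = F (Suc n) \<gamma> - F n \<gamma>"
  proof (rule the_elem_image_unique)
    show "kid n \<omega> j \<noteq> {}" using \<gamma> by blast
    fix \<gamma>' assume "\<gamma>' \<in> kid n \<omega> j"
    then show "F (Suc n) \<gamma>' - F n \<gamma>' = F (Suc n) \<gamma> - F n \<gamma>" by (simp only: val \<gamma>)
  qed
  then show ?thesis using val[OF \<gamma>] by (simp add: diff_string_def)
qed

lemma atom_sets: "\<omega> \<in> atoms n \<Longrightarrow> \<omega> \<in> sets (tree_borel :: (nat \<Rightarrow> 'm::finite) measure)"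
  by (auto simp: tree_borel_def atoms_def intro!: sigma_sets.Basic openin_cylinder)

section \<open>Integrals over the tree\<close>

lemma nn_integral_simple_sum:
  fixes c :: "'i \<Rightarrow> real"
  assumes "finite_measure \<nu>" "finite I" "\<And>i. i \<in> I \<Longrightarrow> 0 \<le> c i" "\<And>i. i \<in> I \<Longrightarrow> B i \<in> sets \<nu>"
  shows "(\<integral>\<^sup>+ \<gamma>. ennreal (\<Sum>i\<in>I. c i * indicator (B i) \<gamma>) \<partial>\<nu>) = ennreal (\<Sum>i\<in>I. c i * measure \<nu> (B i))"
proof -
  interpret finite_measure \<nu> by fact
  have int: "integrable \<nu> (\<lambda>\<gamma>. c i * indicator (B i) \<gamma>)" if "i \<in> I" for i
    using assms(4)[OF that]
    by (intro integrable_mult_right integrable_real_indicator) (auto simp: less_top[symmetric])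
  have "(\<integral>\<^sup>+ \<gamma>. ennreal (\<Sum>i\<in>I. c i * indicator (B i) \<gamma>) \<partial>\<nu>)
      = ennreal (LINT \<gamma>|\<nu>. (\<Sum>i\<in>I. c i * indicator (B i) \<gamma>))"
  proof (rule nn_integral_eq_integral)
    show "integrable \<nu> (\<lambda>\<gamma>. \<Sum>i\<in>I. c i * indicator (B i) \<gamma>)"
      using int by (rule Bochner_Integration.integrable_sum)
    show "AE \<gamma> in \<nu>. 0 \<le> (\<Sum>i\<in>I. c i * indicator (B i) \<gamma>)"
      using assms(3) by (intro AE_I2 sum_nonneg mult_nonneg_nonneg) auto
  qed
  also have "(LINT \<gamma>|\<nu>. (\<Sum>i\<in>I. c i * indicator (B i) \<gamma>))
      = (\<Sum>i\<in>I. LINT \<gamma>|\<nu>. c i * indicator (B i) \<gamma>)"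
    using int by (rule Bochner_Integration.integral_sum)
  also have "\<dots> = (\<Sum>i\<in>I. c i * measure \<nu> (B i))"
    using assms(4) sets.sets_into_space by (intro sum.cong) (auto simp: Int_absorb2)
  finally show ?thesis .
qed

lemma sum_indicator_atoms:
  fixes g :: "(nat \<Rightarrow> 'm::finite) set \<Rightarrow> real"
  shows "(\<Sum>\<omega>\<in>atoms n. g \<omega> * indicator \<omega> \<gamma>) = g (cylinder n \<gamma>)"
proof -
  have "(\<Sum>\<omega>\<in>atoms n. g \<omega> * indicator \<omega> \<gamma>) = (\<Sum>\<omega>\<in>{cylinder n \<gamma>}. g \<omega> * indicator \<omega> \<gamma>)"
  proof (rule sum.mono_neutral_right[OF finite_atoms])
    show "{cylinder n \<gamma>} \<subseteq> atoms n" by (auto simp: atoms_def)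
    show "\<forall>\<omega>\<in>atoms n - {cylinder n \<gamma>}. g \<omega> * indicator \<omega> \<gamma> = 0"
      using atom_eq_cylinder by (auto simp: indicator_def)
  qed
  also have "\<dots> = g (cylinder n \<gamma>)" by (simp add: cylinder_def)
  finally show ?thesis .
qed

lemma expectation_norm:
  fixes f :: "(nat \<Rightarrow> 'm::finite) \<Rightarrow> real ^ 'l::finite"
  assumes f: "f \<in> borel_measurable (level_algebra n)"
  shows "(\<integral>\<^sup>+ \<gamma>. ennreal (norm (f \<gamma>)) \<partial>tree_prob)
    = ennreal ((\<Sum>\<omega>\<in>atoms n. norm (atom_value f \<omega>)) / real CARD('m) ^ n)"
proof -
  have "norm (f \<gamma>) = (\<Sum>\<omega>\<in>atoms n. norm (atom_value f \<omega>) * indicator \<omega> \<gamma>)" for \<gamma>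
  proof -
    have "atom_value f (cylinder n \<gamma>) = f \<gamma>"
      by (rule atom_value_eq[OF f]) (auto simp: atoms_def cylinder_def)
    then show ?thesis by (simp add: sum_indicator_atoms)
  qed
  then have "(\<integral>\<^sup>+ \<gamma>. ennreal (norm (f \<gamma>)) \<partial>tree_prob)
      = (\<integral>\<^sup>+ \<gamma>. ennreal (\<Sum>\<omega>\<in>atoms n. norm (atom_value f \<omega>) * indicator \<omega> \<gamma>) \<partial>tree_prob)" by simp
  also have "\<dots> = ennreal (\<Sum>\<omega>\<in>atoms n. norm (atom_value f \<omega>) * measure tree_prob \<omega>)"
    using atom_sets prob_space_tree_prob
    by (intro nn_integral_simple_sum) (auto simp: sets_tree_borel finite_atoms prob_space_def)
  also have "(\<Sum>\<omega>\<in>atoms n. norm (atom_value f \<omega>) * measure tree_prob \<omega>)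
      = (\<Sum>\<omega>\<in>atoms n. norm (atom_value f \<omega>)) / real CARD('m) ^ n"
    unfolding sum_divide_distrib
    by (intro sum.cong) (auto simp: measure_def emeasure_tree_prob_atom power_divide)
  finally show ?thesis .
qed

lemma measure_kids:
  fixes \<nu> :: "(nat \<Rightarrow> 'm::finite) measure"
  assumes fin: "finite_measure \<nu>" and sets: "sets \<nu> = sets tree_borel" and \<omega>: "\<omega> \<in> atoms n"
  shows "(\<Sum>j\<in>UNIV. measure \<nu> (kid n \<omega> j)) = measure \<nu> \<omega>"
proof -
  interpret finite_measure \<nu> by fact
  have "measure \<nu> (\<Union>j\<in>UNIV. kid n \<omega> j) = (\<Sum>j\<in>UNIV. measure \<nu> (kid n \<omega> j))"
    using atom_sets[OF kid_in_atoms[OF \<omega>]]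
    by (intro finite_measure_finite_Union) (auto simp: sets disjoint_family_on_def kid_def)
  moreover have "(\<Union>j\<in>UNIV. kid n \<omega> j) = \<omega>" by (auto simp: kid_def)
  ultimately show ?thesis by simp
qed

text \<open>The sum in the potential is finite because the increments of a simple martingale vanish from some level on.  The
triangle inequality over levels, atoms and kids gives up cancellation between levels; the single-step estimate uses only the
cancellation of \<open>\<phi>\<close> on supports of extremal vectors.\<close>

lemma riesz_potential_bound:
  fixes F :: "nat \<Rightarrow> (nat \<Rightarrow> 'm::finite) \<Rightarrow> real ^ 'l::finite"
  assumes F: "\<And>n. F n \<in> borel_measurable (level_algebra n)" and N: "\<And>n. n \<ge> N \<Longrightarrow> F n = F N"
    and phi0: "\<phi> 0 = 0"
    and fin: "finite_measure \<nu>" and sets: "sets \<nu> = sets tree_borel"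
  shows "(\<integral>\<^sup>+ \<gamma>. ennreal \<bar>riesz_potential \<alpha> \<phi> F \<gamma>\<bar> \<partial>\<nu>)
    \<le> ennreal (\<Sum>n<N. \<Sum>\<omega>\<in>atoms n. \<Sum>j\<in>UNIV.
        real CARD('m) powr (- \<alpha> * real n) * \<bar>\<phi> (diff_string F n \<omega>) $ j\<bar> * measure \<nu> (kid n \<omega> j))"
proof -
  define I :: "(nat \<times> (nat \<Rightarrow> 'm) set \<times> 'm) set" where "I = (SIGMA n:{..<N}. atoms n \<times> UNIV)"
  define c where "c i = real CARD('m) powr (- \<alpha> * real (fst i)) * \<bar>\<phi> (diff_string F (fst i) (fst (snd i))) $ snd (snd i)\<bar>"
    for i :: "nat \<times> (nat \<Rightarrow> 'm) set \<times> 'm"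
  define B where "B i = kid (fst i) (fst (snd i)) (snd (snd i))" for i :: "nat \<times> (nat \<Rightarrow> 'm) set \<times> 'm"
  have finI: "finite I" by (auto simp: I_def finite_atoms)
  have expand: "(\<Sum>i\<in>I. g (fst i) (fst (snd i)) (snd (snd i))) = (\<Sum>n<N. \<Sum>\<omega>\<in>atoms n. \<Sum>j\<in>UNIV. g n \<omega> j)"
    for g :: "nat \<Rightarrow> (nat \<Rightarrow> 'm) set \<Rightarrow> 'm \<Rightarrow> real"
  proof -
    have "(\<Sum>n<N. \<Sum>\<omega>\<in>atoms n. \<Sum>j\<in>UNIV. g n \<omega> j)
        = (\<Sum>n<N. \<Sum>p\<in>atoms n \<times> UNIV. g n (fst p) (snd p))"
      by (simp add: sum.cartesian_product split_beta)
    also have "\<dots> = (\<Sum>i\<in>I. g (fst i) (fst (snd i)) (snd (snd i)))"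
      unfolding I_def by (subst sum.Sigma) (auto simp: finite_atoms split_beta)
    finally show ?thesis ..
  qed
  have zero: "diff_string F n \<omega> = 0" if "n \<ge> N" "\<omega> \<in> atoms n" for n \<omega>
  proof -
    have "F (Suc n) = F n" using N[of n] N[of "Suc n"] that(1) by simp
    then have "(\<lambda>\<gamma>. F (Suc n) \<gamma> - F n \<gamma>) ` kid n \<omega> j = {0}" for j
      using kid_nonempty[OF that(2), of j] by auto
    then show ?thesis by (simp add: diff_string_def vec_eq_iff)
  qed
  have pw: "\<bar>riesz_potential \<alpha> \<phi> F \<gamma>\<bar> \<le> (\<Sum>i\<in>I. c i * indicator (B i) \<gamma>)" for \<gamma>
  proof -
    have "riesz_potential \<alpha> \<phi> F \<gamma> = (\<Sum>n<N. real CARD('m) powr (- \<alpha> * real n) *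
        (\<Sum>\<omega>\<in>atoms n. \<Sum>j\<in>UNIV. \<phi> (diff_string F n \<omega>) $ j * indicator (kid n \<omega> j) \<gamma>))"
      unfolding riesz_potential_def by (rule suminf_finite) (auto simp: zero phi0)
    also have "\<bar>\<dots>\<bar> \<le> (\<Sum>n<N. \<Sum>\<omega>\<in>atoms n. \<Sum>j\<in>UNIV. real CARD('m) powr (- \<alpha> * real n) *
        \<bar>\<phi> (diff_string F n \<omega>) $ j\<bar> * indicator (kid n \<omega> j) \<gamma>)"
      unfolding sum_distrib_left
      by (intro sum_abs[THEN order_trans] sum_mono) (auto simp: abs_mult indicator_def)
    also have "\<dots> = (\<Sum>i\<in>I. c i * indicator (B i) \<gamma>)"
      unfolding c_def B_def
      by (rule expand[symmetric])
    finally show ?thesis .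
  qed
  have "(\<integral>\<^sup>+ \<gamma>. ennreal \<bar>riesz_potential \<alpha> \<phi> F \<gamma>\<bar> \<partial>\<nu>) \<le> (\<integral>\<^sup>+ \<gamma>. ennreal (\<Sum>i\<in>I. c i * indicator (B i) \<gamma>) \<partial>\<nu>)"
    by (intro nn_integral_mono ennreal_leI pw)
  also have "\<dots> = ennreal (\<Sum>i\<in>I. c i * measure \<nu> (B i))"
    using fin finI
    by (rule nn_integral_simple_sum)
       (auto simp: c_def B_def I_def sets intro!: atom_sets kid_in_atoms)
  also have "(\<Sum>i\<in>I. c i * measure \<nu> (B i)) = (\<Sum>n<N. \<Sum>\<omega>\<in>atoms n. \<Sum>j\<in>UNIV.
        real CARD('m) powr (- \<alpha> * real n) * \<bar>\<phi> (diff_string F n \<omega>) $ j\<bar> * measure \<nu> (kid n \<omega> j))"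
    unfolding c_def B_def by (rule expand)
  finally show ?thesis .
qed

section \<open>Summation over the tree\<close>

text \<open>With \<open>t \<omega> = m\<^bsup>(1 - \<alpha>) n\<^esup> \<nu> \<omega> / A0\<close>, the weight \<open>m\<^bsup>- \<alpha> n\<^esup> \<nu> (\<omega>\<^sub>j)\<close> is \<open>m\<^sup>\<alpha> A0 m\<^bsup>-(n + 1)\<^esup> t (\<omega>\<^sub>j)\<close>, and the
masses of the kids add up as in the single-step inequality.  Averaging that inequality over the atoms of level \<open>n\<close> gives
increments of the sequences \<open>S\<close> (the mean of the norm) and \<open>T\<close> (its mean weighted by \<open>\<surd>t\<close>), which
telescope; \<open>0 \<le> T \<le> S\<close>.\<close>

lemma telescoped_estimate:
  fixes F :: "nat \<Rightarrow> (nat \<Rightarrow> 'm::finite) \<Rightarrow> real ^ 'l::finite" and \<alpha> A0 :: real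
  assumes m2: "CARD('m) \<ge> 2"
    and F: "\<And>n. F n \<in> borel_measurable (level_algebra n)"
    and FW: "\<And>n \<omega>. \<omega> \<in> atoms n \<Longrightarrow> diff_string F n \<omega> \<in> W"
    and fin: "finite_measure \<nu>" and sets: "sets \<nu> = sets tree_borel"
    and A0: "A0 > 0"
    and morrey: "\<And>n \<omega>. \<omega> \<in> atoms n \<Longrightarrow> real CARD('m) powr ((1 - \<alpha>) * real n) * measure \<nu> \<omega> \<le> A0"
    and C: "C1 \<ge> 0" "C2 \<ge> 0"
    and bellman: "\<And>x w r \<tau>. w \<in> W \<Longrightarrow> 0 \<le> \<tau> \<Longrightarrow> \<tau> \<le> 1 \<Longrightarrow> (\<forall>j. 0 \<le> r j) \<Longrightarrow>
      (\<Sum>j\<in>UNIV. (r j)\<^sup>2) = real CARD('m) / real CARD('m) powr \<alpha> * \<tau>\<^sup>2 \<Longrightarrow>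
      (\<Sum>j\<in>UNIV. \<bar>\<phi> w $ j\<bar> * (r j)\<^sup>2)
      \<le> C1 * l1_defect x w + C2 * (real CARD('m) * \<tau> * norm x - (\<Sum>j\<in>UNIV. norm (x + w $ j) * r j))"
  defines "S \<equiv> \<lambda>n. (\<Sum>\<omega>\<in>atoms n. norm (atom_value (F n) \<omega>)) / real CARD('m) ^ n"
  shows "(\<Sum>n<N. \<Sum>\<omega>\<in>atoms n. \<Sum>j\<in>UNIV.
        real CARD('m) powr (- \<alpha> * real n) * \<bar>\<phi> (diff_string F n \<omega>) $ j\<bar> * measure \<nu> (kid n \<omega> j))
    \<le> real CARD('m) powr \<alpha> * A0 * (C1 * S N + C2 * S 0)"
proof -
  define m where "m = real CARD('m)"
  have m: "m \<ge> 2" using m2 by (simp add: m_def)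
  define t where "t n \<omega> = m powr ((1 - \<alpha>) * real n) * measure \<nu> \<omega> / A0" for n \<omega>
  have t: "0 \<le> t n \<omega>" "t n \<omega> \<le> 1" if "\<omega> \<in> atoms n" for n \<omega>
    using morrey[OF that] A0 by (auto simp: t_def m_def)
  have kids: "(\<Sum>j\<in>UNIV. t (Suc n) (kid n \<omega> j)) = m / m powr \<alpha> * t n \<omega>" if "\<omega> \<in> atoms n" for n \<omega>
  proof -
    have "(\<Sum>j\<in>UNIV. t (Suc n) (kid n \<omega> j)) = m powr ((1 - \<alpha>) * real (Suc n)) * measure \<nu> \<omega> / A0"
      unfolding t_def measure_kids[OF fin sets that, symmetric] by (simp add: sum_distrib_left sum_divide_distrib)
    also have "m powr ((1 - \<alpha>) * real (Suc n)) = m powr (1 - \<alpha>) * m powr ((1 - \<alpha>) * real n)"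
      by (simp add: powr_add[symmetric] algebra_simps)
    also have "m powr (1 - \<alpha>) = m / m powr \<alpha>" using m by (simp add: powr_diff)
    finally show ?thesis by (simp add: t_def)
  qed
  define X where "X n \<omega> = norm (atom_value (F n) \<omega>)" for n \<omega>
  define T where "T n = (\<Sum>\<omega>\<in>atoms n. X n \<omega> * sqrt (t n \<omega>)) / m ^ n" for n
  have S: "S n = (\<Sum>\<omega>\<in>atoms n. X n \<omega>) / m ^ n" for n by (simp add: S_def X_def m_def)
  have weight: "m powr (- \<alpha> * real n) * measure \<nu> (kid n \<omega> j) = m powr \<alpha> * A0 * t (Suc n) (kid n \<omega> j) / m ^ Suc n" for n \<omega> j
  proof -
    have "m powr (- \<alpha> * real n) = m powr \<alpha> * m powr ((1 - \<alpha>) * real (Suc n)) / m powr real (Suc n)"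
      using m by (simp add: powr_add[symmetric] powr_diff[symmetric] algebra_simps)
    also have "m powr real (Suc n) = m ^ Suc n" using m by (subst powr_realpow) auto
    finally show ?thesis using A0 by (simp add: t_def)
  qed
  have step: "(\<Sum>j\<in>UNIV. m powr (- \<alpha> * real n) * \<bar>\<phi> (diff_string F n \<omega>) $ j\<bar> * measure \<nu> (kid n \<omega> j))
    \<le> m powr \<alpha> * A0 / m ^ Suc n * (C1 * ((\<Sum>j\<in>UNIV. X (Suc n) (kid n \<omega> j)) - m * X n \<omega>)
      + C2 * (m * (X n \<omega> * sqrt (t n \<omega>)) - (\<Sum>j\<in>UNIV. X (Suc n) (kid n \<omega> j) * sqrt (t (Suc n) (kid n \<omega> j)))))"
    if \<omega>: "\<omega> \<in> atoms n" for n \<omega>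
  proof -
    have child: "atom_value (F n) \<omega> + diff_string F n \<omega> $ j = atom_value (F (Suc n)) (kid n \<omega> j)" for j
      using diff_string_nth[OF F \<omega>, of j] by simp
    have tk: "0 \<le> t (Suc n) (kid n \<omega> j)" for j using t(1)[OF kid_in_atoms[OF \<omega>]] .
    have "(\<Sum>j\<in>UNIV. m powr (- \<alpha> * real n) * \<bar>\<phi> (diff_string F n \<omega>) $ j\<bar> * measure \<nu> (kid n \<omega> j))
      = (\<Sum>j\<in>UNIV. \<bar>\<phi> (diff_string F n \<omega>) $ j\<bar> * (m powr (- \<alpha> * real n) * measure \<nu> (kid n \<omega> j)))"
      by (intro sum.cong) auto
    also have "\<dots> = m powr \<alpha> * A0 / m ^ Suc n * (\<Sum>j\<in>UNIV. \<bar>\<phi> (diff_string F n \<omega>) $ j\<bar> * (sqrt (t (Suc n) (kid n \<omega> j)))\<^sup>2)"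
      unfolding weight sum_distrib_left using tk by (intro sum.cong) auto
    also have "\<dots> \<le> m powr \<alpha> * A0 / m ^ Suc n *
      (C1 * l1_defect (atom_value (F n) \<omega>) (diff_string F n \<omega>)
        + C2 * (real CARD('m) * sqrt (t n \<omega>) * norm (atom_value (F n) \<omega>)
          - (\<Sum>j\<in>UNIV. norm (atom_value (F n) \<omega> + diff_string F n \<omega> $ j) * sqrt (t (Suc n) (kid n \<omega> j)))))"
    proof (intro mult_left_mono bellman FW \<omega>)
      show "(\<Sum>j\<in>UNIV. (sqrt (t (Suc n) (kid n \<omega> j)))\<^sup>2)
          = real CARD('m) / real CARD('m) powr \<alpha> * (sqrt (t n \<omega>))\<^sup>2"
        using kids[OF \<omega>] t(1)[OF \<omega>] tk by (simp add: m_def)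
      show "0 \<le> m powr \<alpha> * A0 / m ^ Suc n" using A0 m by simp
    qed (use t[OF \<omega>] tk in auto)
    finally show ?thesis
      unfolding l1_defect_def child X_def[symmetric] m_def[symmetric] by (simp add: mult_ac)
  qed
  have level: "(\<Sum>\<omega>\<in>atoms n. \<Sum>j\<in>UNIV. m powr (- \<alpha> * real n) * \<bar>\<phi> (diff_string F n \<omega>) $ j\<bar> * measure \<nu> (kid n \<omega> j))
    \<le> m powr \<alpha> * A0 * (C1 * (S (Suc n) - S n) + C2 * (T n - T (Suc n)))" for n
  proof -
    have "(\<Sum>\<omega>\<in>atoms n. \<Sum>j\<in>UNIV. m powr (- \<alpha> * real n) * \<bar>\<phi> (diff_string F n \<omega>) $ j\<bar> * measure \<nu> (kid n \<omega> j))
      \<le> (\<Sum>\<omega>\<in>atoms n. m powr \<alpha> * A0 / m ^ Suc n * (C1 * ((\<Sum>j\<in>UNIV. X (Suc n) (kid n \<omega> j)) - m * X n \<omega>)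
      + C2 * (m * (X n \<omega> * sqrt (t n \<omega>)) - (\<Sum>j\<in>UNIV. X (Suc n) (kid n \<omega> j) * sqrt (t (Suc n) (kid n \<omega> j))))))"
      by (rule sum_mono) (rule step)
    also have "\<dots> = m powr \<alpha> * A0 / m ^ Suc n * (C1 * ((\<Sum>\<omega>\<in>atoms (Suc n). X (Suc n) \<omega>) - m * (\<Sum>\<omega>\<in>atoms n. X n \<omega>))
      + C2 * (m * (\<Sum>\<omega>\<in>atoms n. X n \<omega> * sqrt (t n \<omega>)) - (\<Sum>\<omega>\<in>atoms (Suc n). X (Suc n) \<omega> * sqrt (t (Suc n) \<omega>))))"
      unfolding sum_atoms_Suc by (simp only: sum_distrib_left[symmetric] sum.distrib sum_subtractf)
    also have "\<dots> = m powr \<alpha> * A0 * (C1 * (S (Suc n) - S n) + C2 * (T n - T (Suc n)))"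
      using m by (simp add: S T_def field_simps)
    finally show ?thesis .
  qed
  have T: "0 \<le> T n" for n
    unfolding T_def using t m by (intro divide_nonneg_nonneg sum_nonneg mult_nonneg_nonneg) (auto simp: X_def)
  have S0: "0 \<le> S n" for n unfolding S_def by (simp add: sum_nonneg)
  have TS: "T 0 \<le> S 0"
    unfolding T_def S using t m by (intro divide_right_mono sum_mono) (auto simp: X_def mult_left_le)
  have "(\<Sum>n<N. \<Sum>\<omega>\<in>atoms n. \<Sum>j\<in>UNIV. m powr (- \<alpha> * real n) * \<bar>\<phi> (diff_string F n \<omega>) $ j\<bar> * measure \<nu> (kid n \<omega> j))
    \<le> (\<Sum>n<N. m powr \<alpha> * A0 * (C1 * (S (Suc n) - S n) + C2 * (T n - T (Suc n))))"
    by (rule sum_mono) (rule level)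
  also have "\<dots> = m powr \<alpha> * A0 * (C1 * (S N - S 0) + C2 * (T 0 - T N))"
    by (simp only: sum_distrib_left[symmetric] sum.distrib sum_lessThan_telescope sum_lessThan_telescope')
  also have "\<dots> \<le> m powr \<alpha> * A0 * (C1 * S N + C2 * S 0)"
    using A0 m C S0[of 0] T[of N] TS
    by (intro mult_left_mono add_mono) auto
  finally show ?thesis by (simp add: m_def)
qed

theorem theorem5p1:
  fixes W :: "(real ^ 'l::finite ^ 'm::finite) set"
    and \<phi> :: "real ^ 'l ^ 'm \<Rightarrow> real ^ 'm"
    and \<alpha> :: real
  assumes "CARD('m) \<ge> 2"
    and "subspace W" and "W \<subseteq> VR_space"
    and "geometric W"
    and "\<alpha> = order_of_space W" and "0 < \<alpha>" and "\<alpha> < 1"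
    and "nonlocal \<alpha> W"
    and "linear_into_V W \<phi>"
    and "canceling \<alpha> W \<phi>"
  shows "\<exists>C\<ge>0::real. \<forall>F. F \<in> martingale_space W \<and> simple_martingale F \<longrightarrow>
    (\<forall>\<nu> :: (nat \<Rightarrow> 'm) measure.
       finite_measure \<nu> \<and> sets \<nu> = sets tree_borel \<and>
       (SUP n. SUP \<omega>\<in>atoms n. ennreal (real CARD('m) powr ((1 - \<alpha>) * real n)) * emeasure \<nu> \<omega>) < \<infinity> \<longrightarrow>
       (\<integral>\<^sup>+ \<gamma>. ennreal \<bar>riesz_potential \<alpha> \<phi> F \<gamma>\<bar> \<partial>\<nu>)
         \<le> ennreal C *
            (SUP n. SUP \<omega>\<in>atoms n. ennreal (real CARD('m) powr ((1 - \<alpha>) * real n)) * emeasure \<nu> \<omega>) *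
            L1_norm F)"
proof -
  have bound: "1 + v $ j \<le> real CARD('m) powr \<alpha>" if "v \<in> M_set W" for v j
    using geometric_imp_M_set_bounded[OF assms(1,2,4) that] assms(5) by simp
  obtain C1 C2 where C: "C1 \<ge> 0" "C2 \<ge> 0" and bellman: "\<And>x w r \<tau>. w \<in> W \<Longrightarrow> 0 \<le> \<tau> \<Longrightarrow> \<tau> \<le> 1 \<Longrightarrow>
      (\<forall>j. 0 \<le> r j) \<Longrightarrow> (\<Sum>j\<in>UNIV. (r j)\<^sup>2) = real CARD('m) / real CARD('m) powr \<alpha> * \<tau>\<^sup>2 \<Longrightarrow>
      (\<Sum>j\<in>UNIV. \<bar>\<phi> w $ j\<bar> * (r j)\<^sup>2)
      \<le> C1 * l1_defect x w + C2 * (real CARD('m) * \<tau> * norm x - (\<Sum>j\<in>UNIV. norm (x + w $ j) * r j))"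
    using bellman_inequality[OF assms(1-3) bound assms(6,8-10) refl] by blast
  define C where "C = real CARD('m) powr \<alpha> * (C1 + C2)"
  have C0: "C \<ge> 0" using \<open>C1 \<ge> 0\<close> \<open>C2 \<ge> 0\<close> by (simp add: C_def)
  note phi0 = linear_into_V_zero[OF assms(2,9)]
  define mor where "mor \<nu> = (SUP n. SUP \<omega>\<in>atoms n. ennreal (real CARD('m) powr ((1 - \<alpha>) * real n)) * emeasure \<nu> \<omega>)"
    for \<nu> :: "(nat \<Rightarrow> 'm) measure"
  have main: "(\<integral>\<^sup>+ \<gamma>. ennreal \<bar>riesz_potential \<alpha> \<phi> F \<gamma>\<bar> \<partial>\<nu>) \<le> ennreal C * mor \<nu> * L1_norm F"
    if FW: "F \<in> martingale_space W" and simple: "simple_martingale F"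
      and fin: "finite_measure \<nu>" and sets: "sets \<nu> = sets tree_borel" and M: "mor \<nu> < \<infinity>"
    for F and \<nu> :: "(nat \<Rightarrow> 'm) measure"
  proof -
    interpret finite_measure \<nu> by fact
    have F: "F n \<in> borel_measurable (level_algebra n)" for n
      using simple by (simp add: simple_martingale_def tree_martingale_def)
    have dW: "diff_string F n \<omega> \<in> W" if "\<omega> \<in> atoms n" for n \<omega>
      using FW that by (simp add: martingale_space_def)
    obtain N where N: "\<And>n. n \<ge> N \<Longrightarrow> F n = F N"
      using simple by (auto simp: simple_martingale_def)
    define A0 where "A0 = enn2real (mor \<nu>)"
    have MA0: "mor \<nu> = ennreal A0" using M by (simp add: A0_def)
    have morrey: "real CARD('m) powr ((1 - \<alpha>) * real n) * measure \<nu> \<omega> \<le> A0" if "\<omega> \<in> atoms n" for n \<omega>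
    proof -
      have "ennreal (real CARD('m) powr ((1 - \<alpha>) * real n) * measure \<nu> \<omega>)
          = ennreal (real CARD('m) powr ((1 - \<alpha>) * real n)) * emeasure \<nu> \<omega>"
        by (simp add: emeasure_eq_measure ennreal_mult)
      also have "\<dots> \<le> mor \<nu>" unfolding mor_def using that by (intro SUP_upper2[of n] SUP_upper) auto
      finally show ?thesis unfolding MA0 by (simp add: A0_def)
    qed
    define S where "S n = (\<Sum>\<omega>\<in>atoms n. norm (atom_value (F n) \<omega>)) / real CARD('m) ^ n" for n
    have S: "0 \<le> S n" "ennreal (S n) \<le> L1_norm F" for n
    proof -
      show "0 \<le> S n" by (simp add: S_def sum_nonneg)
      show "ennreal (S n) \<le> L1_norm F"
        unfolding S_def expectation_norm[OF F, symmetric] L1_norm_def by (rule SUP_upper) simp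
    qed
    define Z where "Z = (\<Sum>n<N. \<Sum>\<omega>\<in>atoms n. \<Sum>j\<in>UNIV. real CARD('m) powr (- \<alpha> * real n) *
        \<bar>\<phi> (diff_string F n \<omega>) $ j\<bar> * measure \<nu> (kid n \<omega> j))"
    have "Z \<le> real CARD('m) powr \<alpha> * A0 * (C1 * S N + C2 * S 0)"
    \<comment> \<open>For \<open>A0 = 0\<close> the normalized masses are undefined, but then \<open>\<nu>\<close> is zero.\<close>
    proof (cases "A0 = 0")
      case True
      have "measure \<nu> (kid n \<omega> j) = 0" if "\<omega> \<in> atoms n" for n \<omega> j
      proof -
        have "real CARD('m) powr ((1 - \<alpha>) * real (Suc n)) > 0" using assms(1) by simp
        then show ?thesis
          using morrey[OF kid_in_atoms[OF that, of j]] True by (simp add: mult_le_0_iff order_antisym_conv)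
      qed
      then show ?thesis using True by (simp add: Z_def)
    next
      case False
      then have "A0 > 0" by (simp add: A0_def less_le)
      from telescoped_estimate[OF assms(1) F dW fin sets this morrey C bellman]
      show ?thesis unfolding Z_def S_def .
    qed
    then have "ennreal Z \<le> ennreal (real CARD('m) powr \<alpha> * A0 * (C1 * S N + C2 * S 0))" by (rule ennreal_leI)
    also have "\<dots> = ennreal (real CARD('m) powr \<alpha>) * ennreal A0 * (ennreal C1 * ennreal (S N) + ennreal C2 * ennreal (S 0))"
      using C S(1) by (simp add: A0_def ennreal_mult ennreal_plus)
    also have "\<dots> \<le> ennreal (real CARD('m) powr \<alpha>) * ennreal A0 * (ennreal C1 * L1_norm F + ennreal C2 * L1_norm F)"
      by (intro mult_left_mono add_mono S) auto
    also have "\<dots> = ennreal C * ennreal A0 * L1_norm F"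
      using C by (simp add: C_def ennreal_mult ennreal_plus algebra_simps)
    finally show ?thesis
      using riesz_potential_bound[where \<phi> = \<phi> and \<alpha> = \<alpha>, OF F N phi0 fin sets]
      unfolding Z_def MA0 by (rule order_trans[rotated])
  qed
  show ?thesis using C0 main unfolding mor_def by blast
qed

end
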